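(* (i) $s_5\neq 0$ on $\mathrm{Vect}_0(2)$, i.e. $s_5(X_1,\ldots,X_5)\ne0$ for some $X_1,\ldots,X_5\in \mathrm{Vect}_0(2)$. (ii) $s_5$ is a $5$-commutator on $\mathrm{Vect}_0(2)$, i.e. $s_5(X_1,\ldots,X_5)\in \mathrm{Vect}_0(2)$ for all $X_1,\ldots,X_5\in \mathrm{Vect}_0(2)$. (iii) $s_6=0$ is an identity on $\mathrm{Vect}_0(2)$, i.e. $s_6(X_1,\ldots,X_6)=0$ for all $X_1,\ldots,X_6\in \mathrm{Vect}_0(2)$. (iv) The $5$-commutator $s_5$ on $\mathrm{Vect}_0(2)$ is primitive. (v) $s_5(X_1,\ldots,X_5)=s_5^{\mathrm{rsym.r}}(X_1,\ldots,X_5)$ for all $X_1,\ldots,X_5\in \mathrm{Vect}_0(2)$. (vi) $\mathrm{ad}\,s_5(X_1,\ldots,X_5)=s_5(\mathrm{ad}\,X_1,\ldots,\mathrm{ad}\,X_5)$ (as linear operators on $\mathrm{Vect}_0(2)$) for all $X_1,\ldots,X_5\in \mathrm{Vect}_0(2)$. (vii) $(\mathrm{Vect}_0(2),s_5)$ is a $4$-left commutative algebra. (viii) $(\mathrm{Vect}_0(2),\{s_2,s_5\})$ is an $sh$-Lie algebra.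
   Context: Let $U=\mathbb{C}[x_1,x_2]$, $\partial_i=\partial/\partial x_i$, and let $\mathrm{Diff}(2)$ be the space of differential operators $\sum_\alpha u_\alpha\partial^\alpha$ (finite sums, $u_\alpha\in U$). Operators are written as acting on the right: $(f)X$ is the result of applying $X$ to $f$, and $X\cdot Y$ is composition in the order "first $X$, then $Y$"; thus $u\partial_i\cdot v\partial_j=v\,\partial_j(u)\,\partial_i+uv\,\partial_i\partial_j$. $\mathrm{Vect}(2)=\{u_1\partial_1+u_2\partial_2\}$, $\mathrm{Div}(u_1\partial_1+u_2\partial_2)=\partial_1(u_1)+\partial_2(u_2)$, $\mathrm{Vect}_0(2)=\{X\in\mathrm{Vect}(2):\mathrm{Div}\,X=0\}$. Put $[X,Y]=X\cdot Y-Y\cdot X$ and $(Y)\,\mathrm{ad}\,X=[Y,X]$. For elements $t_1,\ldots,t_k$ of an associative algebra, $s_k(t_1,\ldots,t_k)=\sum_{\sigma\in \mathrm{Sym}_k}\mathrm{sign}(\sigma)\,t_{\sigma(1)}\cdots t_{\sigma(k)}$. For vector fields this is computed in $(\mathrm{Diff}(2),\cdot)$; for $\mathrm{ad}\,X_i$ it is computed in the algebra of linear operators (also acting on the right) on $\mathrm{Vect}_0(2)$, so $(Y)s_5(\mathrm{ad}X_1,\ldots,\mathrm{ad}X_5)=\sum_\sigma \mathrm{sign}(\sigma)[\cdots[[Y,X_{\sigma(1)}],X_{\sigma(2)}],\ldots,X_{\sigma(5)}]$. The right-symmetric multiplication is $u\partial_i\circ v\partial_j=v\,\partial_j(u)\,\partial_i$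 on $\mathrm{Vect}(2)$ (bilinear), and $s_5^{\mathrm{rsym.r}}(X_1,\ldots,X_5)=\sum_{\sigma\in \mathrm{Sym}_5}\mathrm{sign}(\sigma)\,(((X_{\sigma(1)}\circ X_{\sigma(2)})\circ X_{\sigma(3)})\circ X_{\sigma(4)})\circ X_{\sigma(5)}$. Primitive: $s_5$ is primitive on $\mathrm{Vect}_0(2)$ if there is no noncommutative polynomial $f(t_1,\ldots,t_5)$ such that $s_5(X_1,\ldots,X_5)=f^{[\,,\,]}(X_1,\ldots,X_5)$ for all $X_1,\ldots,X_5\in\mathrm{Vect}_0(2)$, where $f^{[\,,\,]}$ is obtained by replacing each monomial $t_{i_1}t_{i_2}\cdots t_{i_l}$ of $f$ by the left-normed commutator $[\cdots[[X_{i_1},X_{i_2}],X_{i_3}],\ldots,X_{i_l}]$. For a skew-symmetric $m$-linear operation $\omega$ on $A$, $(A,\omega)$ is $(m-1)$-left commutative if $\sum_{\sigma\in \mathrm{Sym}_{2m-2}}\mathrm{sign}(\sigma)\,\omega(a_{\sigma(1)},\ldots,a_{\sigma(m-1)},\omega(a_{\sigma(m)},\ldots,a_{\sigma(2m-2)},a_{2m-1}))=0$ for all $a_1,\ldots,a_{2m-1}\in A$, and $m$-homotopical Lie if $\sum_{\sigma\in \mathrm{Sym}_{2m-1}}\mathrm{sign}(\sigma)\,\omega(a_{\sigma(1)},\ldots,a_{\sigma(m-1)},\omega(a_{\sigma(m)},\ldots,a_{\sigma(2m-1)}))=0$ for all $a_i\in A$. For skew-symmetric operations $\omega_2$ (2-linear)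 and $\omega_m$ ($m$-linear, $m>2$), $(A,\{\omega_2,\omega_m\})$ is $sh$-Lie (strongly homotopical Lie, all other operations being zero) means: $(A,\omega_2)$ is a Lie algebra, $(A,\omega_m)$ is $m$-homotopical Lie, and $\omega_m$ is an $m$-cocycle of the adjoint module of $(A,\omega_2)$, i.e., writing $[\,,\,]=\omega_2$, $$\sum_{i<j}(-1)^{i+j}\omega_m([a_i,a_j],a_1,\ldots,\widehat{a_i},\ldots,\widehat{a_j},\ldots,a_{m+1})+\sum_{i=1}^{m+1}(-1)^{i+1}[a_i,\omega_m(a_1,\ldots,\widehat{a_i},\ldots,a_{m+1})]=0.$$ *)

theory Defs
  imports
    Complex_Main
    "HOL-Computational_Algebra.Polynomial"
    "HOL-Combinatorics.Permutations"
    "HOL-Library.Function_Algebras"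
    "HOL-Library.Poly_Mapping"
begin

subsection \<open>Differential operators and vector fields in two variables\<close>

text \<open>\<open>\<complex>[x\<^sub>1, x\<^sub>2]\<close> is represented as \<open>\<complex>[x\<^sub>1][x\<^sub>2]\<close>: the outer polynomial variable is \<open>x\<^sub>2\<close>.\<close>

type_synonym U = "complex poly poly"

definition x1 :: U where "x1 = [:[:0, 1:]:]"
definition x2 :: U where "x2 = [:0, 1:]"

definition d1 :: "U \<Rightarrow> U" where "d1 = map_poly pderiv"
definition d2 :: "U \<Rightarrow> U" where "d2 = pderiv"

text \<open>
  A differential operator is identified with the map \<open>f \<mapsto> (f)X\<close> that it induces on \<open>U\<close>.
  In characteristic 0 this identification is injective and makes \<open>Diff(2)\<close> a subalgebra of the
  algebra of linear maps \<open>U \<rightarrow> U\<close>, so products and sums may be computed in the latter.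
  Sums, differences and 0 of operators are the pointwise ones of \<open>Function_Algebras\<close>; the
  pointwise product \<open>*\<close> of functions is never used on operators.
\<close>

type_synonym oper = "U \<Rightarrow> U"

definition rcomp :: "('a \<Rightarrow> 'a) \<Rightarrow> ('a \<Rightarrow> 'a) \<Rightarrow> 'a \<Rightarrow> 'a"  (infixl "\<cdot>\<^sub>r" 70)
  where "X \<cdot>\<^sub>r Y = (\<lambda>f. Y (X f))"

definition cscale :: "complex \<Rightarrow> oper \<Rightarrow> oper"
  where "cscale c X = (\<lambda>f. smult [:c:] (X f))"

lemma vector_space_cscale: "vector_space cscale"
  by unfold_locales (auto simp: cscale_def fun_eq_iff smult_add_right smult_add_left[symmetric] mult.commute pCons_one)

definition vf :: "U \<Rightarrow> U \<Rightarrow> oper"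
  where "vf u1 u2 = (\<lambda>f. u1 * d1 f + u2 * d2 f)"

definition Vect2 :: "oper set"
  where "Vect2 = {vf u1 u2 | u1 u2. True}"

text \<open>The coefficients of a vector field \<open>X = u\<^sub>1\<partial>\<^sub>1 + u\<^sub>2\<partial>\<^sub>2\<close> are \<open>u\<^sub>i = (x\<^sub>i)X\<close>.\<close>

lemma vf_x1: "vf u1 u2 x1 = u1" and vf_x2: "vf u1 u2 x2 = u2"
proof -
  have "d1 x1 = 1" "d2 x1 = 0" "d1 x2 = 0" "d2 x2 = 1"
    by (auto simp: d1_def d2_def x1_def x2_def poly_eq_iff coeff_map_poly coeff_pCons
        pderiv_pCons pCons_one split: nat.splits)
  then show "vf u1 u2 x1 = u1" "vf u1 u2 x2 = u2"
    by (simp_all add: vf_def)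
qed

definition Div :: "oper \<Rightarrow> U"
  where "Div X = d1 (X x1) + d2 (X x2)"

lemma Div_vf: "Div (vf u1 u2) = d1 u1 + d2 u2"
  by (simp add: Div_def vf_x1 vf_x2)

definition Vect2_0 :: "oper set"
  where "Vect2_0 = {X \<in> Vect2. Div X = 0}"

definition comm :: "oper \<Rightarrow> oper \<Rightarrow> oper"
  where "comm X Y = X \<cdot>\<^sub>r Y - Y \<cdot>\<^sub>r X"

definition ad :: "oper \<Rightarrow> oper \<Rightarrow> oper"
  where "ad X = (\<lambda>Y. comm Y X)"

text \<open>
  Right-symmetric multiplication, the bilinear extension of
  \<open>u\<partial>\<^sub>i \<circ> v\<partial>\<^sub>j = v \<partial>\<^sub>j(u) \<partial>\<^sub>i\<close>; only meaningful on vector fields.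
\<close>

definition rsym :: "oper \<Rightarrow> oper \<Rightarrow> oper"
  where "rsym X Y = vf (Y (X x1)) (Y (X x2))"

lemma rsym_vf:
  "rsym (vf u1 u2) (vf v1 v2) = vf (v1 * d1 u1 + v2 * d2 u1) (v1 * d1 u2 + v2 * d2 u2)"
  by (simp add: rsym_def vf_x1 vf_x2) (simp add: vf_def)


subsection \<open>Standard skew-symmetric polynomials\<close>

text \<open>
  A \<open>k\<close>-ary operation is a function on lists, of which only the values on lists of length \<open>k\<close>
  matter. Permutations act on the positions \<open>0, \<dots>, k - 1\<close>.
\<close>

definition signed :: "(nat \<Rightarrow> nat) \<Rightarrow> 'a::ab_group_add \<Rightarrow> 'a"
  where "signed \<sigma> x = (if sign \<sigma> = 1 then x else - x)"

text \<open>\<open>((t\<^sub>1 t\<^sub>2) t\<^sub>3) \<dots> t\<^sub>k\<close> for \<open>k \<ge> 1\<close>\<close>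

definition left_normed :: "('a \<Rightarrow> 'a \<Rightarrow> 'a) \<Rightarrow> 'a list \<Rightarrow> 'a"
  where "left_normed opn ts = foldl opn (hd ts) (tl ts)"

definition skew_poly :: "('a::ab_group_add \<Rightarrow> 'a \<Rightarrow> 'a) \<Rightarrow> 'a list \<Rightarrow> 'a"
  where "skew_poly opn ts =
    (\<Sum>\<sigma> | \<sigma> permutes {..<length ts}. signed \<sigma> (left_normed opn (permute_list \<sigma> ts)))"

text \<open>
  \<open>s_std [t\<^sub>1, \<dots>, t\<^sub>k]\<close> is \<open>s\<^sub>k(t\<^sub>1, \<dots>, t\<^sub>k)\<close>, for operators \<open>t\<^sub>i\<close> acting on the right on any
  additive group: differential operators on \<open>U\<close>, or the maps \<open>ad X\<close> on vector fields.
\<close>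

abbreviation s_std :: "('a \<Rightarrow> 'a::ab_group_add) list \<Rightarrow> 'a \<Rightarrow> 'a"
  where "s_std \<equiv> skew_poly rcomp"

abbreviation s_rsym_r :: "oper list \<Rightarrow> oper"
  where "s_rsym_r \<equiv> skew_poly rsym"


subsection \<open>Primitivity\<close>

text \<open>
  Noncommutative polynomials in \<open>t\<^sub>0, \<dots>, t\<^sub>k\<^sub>-\<^sub>1\<close> are finitely supported functions on words
  in \<open>{0, \<dots>, k - 1}\<close>. The empty word is excluded, since it has no left-normed commutator.
\<close>

definition nc_poly :: "nat \<Rightarrow> (nat list \<Rightarrow>\<^sub>0 complex) \<Rightarrow> bool"
  where "nc_poly k f \<longleftrightarrow> (\<forall>w \<in> Poly_Mapping.keys f. w \<noteq> [] \<and> set w \<subseteq> {..<k})"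

definition comm_eval :: "(nat list \<Rightarrow>\<^sub>0 complex) \<Rightarrow> oper list \<Rightarrow> oper"
  where "comm_eval f Xs =
    (\<Sum>w \<in> Poly_Mapping.keys f.
       cscale (Poly_Mapping.lookup f w) (left_normed comm (map (\<lambda>i. Xs ! i) w)))"

definition primitive_on :: "oper set \<Rightarrow> nat \<Rightarrow> (oper list \<Rightarrow> oper) \<Rightarrow> bool"
  where "primitive_on A k \<omega> \<longleftrightarrow>
    \<not> (\<exists>f. nc_poly k f \<and>
           (\<forall>Xs. length Xs = k \<and> set Xs \<subseteq> A \<longrightarrow> \<omega> Xs = comm_eval f Xs))"


subsection \<open>Algebras with skew-symmetric operations\<close>

definition skew_operation ::
  "(complex \<Rightarrow> 'a \<Rightarrow> 'a::ab_group_add) \<Rightarrow> 'a set \<Rightarrow> nat \<Rightarrow> ('a list \<Rightarrow> 'a) \<Rightarrow> bool"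
  where "skew_operation scale A m \<omega> \<longleftrightarrow>
    vector_space scale \<and> module.subspace scale A \<and>
    (\<forall>as. length as = m \<and> set as \<subseteq> A \<longrightarrow> \<omega> as \<in> A) \<and>
    (\<forall>as a b bs. length as + 1 + length bs = m \<and> set as \<union> {a, b} \<union> set bs \<subseteq> A \<longrightarrow>
       \<omega> (as @ (a + b) # bs) = \<omega> (as @ a # bs) + \<omega> (as @ b # bs)) \<and>
    (\<forall>as c a bs. length as + 1 + length bs = m \<and> set as \<union> {a} \<union> set bs \<subseteq> A \<longrightarrow>
       \<omega> (as @ scale c a # bs) = scale c (\<omega> (as @ a # bs))) \<and>
    (\<forall>as \<sigma>. length as = m \<and> set as \<subseteq> A \<and> \<sigma> permutes {..<m} \<longrightarrow>
       \<omega> (permute_list \<sigma> as) = signed \<sigma> (\<omega> as))"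

definition compose_last :: "nat \<Rightarrow> ('a list \<Rightarrow> 'a) \<Rightarrow> 'a list \<Rightarrow> 'a"
  where "compose_last m \<omega> as = \<omega> (take (m - 1) as @ [\<omega> (drop (m - 1) as)])"

text \<open>
  \<open>left_commutative scale A m \<omega>\<close> says that \<open>(A, \<omega>)\<close> is \<open>(m - 1)\<close>-left commutative, \<open>m\<close> being the
  arity. The permutations fix the last of the \<open>2m - 1\<close> positions.
\<close>

definition left_commutative ::
  "(complex \<Rightarrow> 'a \<Rightarrow> 'a::ab_group_add) \<Rightarrow> 'a set \<Rightarrow> nat \<Rightarrow> ('a list \<Rightarrow> 'a) \<Rightarrow> bool"
  where "left_commutative scale A m \<omega> \<longleftrightarrow>
    skew_operation scale A m \<omega> \<and>
    (\<forall>as. length as = 2 * m - 1 \<and> set as \<subseteq> A \<longrightarrow>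
       (\<Sum>\<sigma> | \<sigma> permutes {..<2 * m - 2}. signed \<sigma> (compose_last m \<omega> (permute_list \<sigma> as))) = 0)"

definition homotopical_lie ::
  "(complex \<Rightarrow> 'a \<Rightarrow> 'a::ab_group_add) \<Rightarrow> 'a set \<Rightarrow> nat \<Rightarrow> ('a list \<Rightarrow> 'a) \<Rightarrow> bool"
  where "homotopical_lie scale A m \<omega> \<longleftrightarrow>
    skew_operation scale A m \<omega> \<and>
    (\<forall>as. length as = 2 * m - 1 \<and> set as \<subseteq> A \<longrightarrow>
       (\<Sum>\<sigma> | \<sigma> permutes {..<2 * m - 1}. signed \<sigma> (compose_last m \<omega> (permute_list \<sigma> as))) = 0)"

definition lie_algebra ::
  "(complex \<Rightarrow> 'a \<Rightarrow> 'a::ab_group_add) \<Rightarrow> 'a set \<Rightarrow> ('a list \<Rightarrow> 'a) \<Rightarrow> bool"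
  where "lie_algebra scale A br \<longleftrightarrow>
    skew_operation scale A 2 br \<and>
    (\<forall>a\<in>A. \<forall>b\<in>A. \<forall>c\<in>A.
       br [br [a, b], c] + br [br [b, c], a] + br [br [c, a], b] = 0)"

definition alt_sign :: "nat \<Rightarrow> 'a::ab_group_add \<Rightarrow> 'a"
  where "alt_sign n x = (if even n then x else - x)"

text \<open>
  The list \<open>nths as (- I)\<close> is \<open>as\<close> without the entries at the positions in \<open>I\<close>. As positions
  start from 0, the sign \<open>(-1)\<^sup>i\<^sup>+\<^sup>1\<close> of the 1-based formula becomes \<open>(-1)\<^sup>i\<close>.
\<close>

definition adjoint_cocycle ::
  "'a set \<Rightarrow> ('a::ab_group_add list \<Rightarrow> 'a) \<Rightarrow> nat \<Rightarrow> ('a list \<Rightarrow> 'a) \<Rightarrow> bool"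
  where "adjoint_cocycle A br m \<omega> \<longleftrightarrow>
    (\<forall>as. length as = m + 1 \<and> set as \<subseteq> A \<longrightarrow>
       (\<Sum>j<m + 1. \<Sum>i<j. alt_sign (i + j) (\<omega> (br [as ! i, as ! j] # nths as (- {i, j}))))
     + (\<Sum>i<m + 1. alt_sign i (br [as ! i, \<omega> (nths as (- {i}))])) = 0)"

definition sh_lie ::
  "(complex \<Rightarrow> 'a \<Rightarrow> 'a::ab_group_add) \<Rightarrow> 'a set \<Rightarrow> ('a list \<Rightarrow> 'a) \<Rightarrow> nat \<Rightarrow> ('a list \<Rightarrow> 'a) \<Rightarrow> bool"
  where "sh_lie scale A \<omega>2 m \<omega>m \<longleftrightarrow>
    m > 2 \<and> lie_algebra scale A \<omega>2 \<and> homotopical_lie scale A m \<omega>m \<and>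
    adjoint_cocycle A \<omega>2 m \<omega>m"

end

theory Submission
  imports Defs
begin

text \<open>
  Every divergence-free field is Hamiltonian, \<open>X = D\<^sub>u\<close> with
  \<open>D\<^sub>u f = {u, f} = u\<^sub>x f\<^sub>y - u\<^sub>y f\<^sub>x\<close>, and \<open>[D\<^sub>v, D\<^sub>u] = D\<^bsub>{u, v}\<^esub>\<close>. So all claims are about
  skew-symmetric multidifferential expressions in polynomials \<open>u\<^sub>1, \<dots>, u\<^sub>k\<close>.

  Such expressions are computed as in a Grassmann algebra: take one \<^emph>\<open>odd\<close> Hamiltonian \<open>u\<close>, whose
  partial derivatives (jets) \<open>u\<^sub>i\<^sub>j = \<partial>\<^sub>x\<^sup>i \<partial>\<^sub>y\<^sup>j u\<close> anticommute. Then \<open>s\<^sub>k(D\<^sub>u\<^sub>1, \<dots>, D\<^sub>u\<^sub>k)\<close> is, up to the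
  factor \<open>k!\<close>, the \<open>k\<close>-th power of the odd operator \<open>u\<^sub>x \<partial>\<^sub>y - u\<^sub>y \<partial>\<^sub>x\<close>. Expanding
  and cancelling squares gives the fifth power in closed form (\<open>ham_odd_5\<close>) and
  shows that the sixth power vanishes (\<open>ham_odd_6\<close>). Back in the original setting
  this is \<open>s\<^sub>5(D\<^sub>u\<^sub>1, \<dots>, D\<^sub>u\<^sub>5) = D\<^sub>h\<close> with \<open>h\<close> three times the determinant of the five
  jets of order one and two (\<open>s5_ham\<close>), and \<open>s\<^sub>6 = 0\<close> (\<open>s6_eq_0\<close>). Everything else follows:

  \<^item> \<open>s\<^sub>5\<close> is a vector field whose coefficients are its values at the coordinates, and these
    values are iterated right-symmetric products. It is nonzero because the determinant is
    triangular for a suitable choice of monomials (\<open>s5_nonzero\<close>).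

  \<^item> By \<open>[D\<^sub>v, D\<^sub>u] = D\<^bsub>D\<^sub>u v\<^esub>\<close> the adjoint action on \<open>D\<^sub>v\<close> is the action on the function \<open>v\<close>, so that
    \<open>s\<^sub>5\<close> of the \<open>ad D\<^sub>u\<close> is \<open>ad\<close> of \<open>s\<^sub>5\<close> as soon as \<open>s\<^sub>5\<close> is a vector field (\<open>ad_s5\<close>).

  \<^item> Left commutativity is a pigeonhole argument. Each monomial of the inner \<open>s\<^sub>5\<close> contains four of
    the five jets on alternated arguments. The outer \<open>s\<^sub>5\<close> differentiates it at most twice, so two
    of these jets survive; the outer monomial contributes four of the same five jets on alternated
    arguments, so some jet occurs twice and the alternating sum vanishes
    (\<open>M_word_deriv_M_word_eq_0\<close>). The homotopical Lie identity is this one, alternated further.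

  \<^item> Each of the two sums of the cocycle condition is, up to a factor, an alternating sum over six
    arguments of products of all six of them, hence a combination of values of \<open>s\<^sub>6\<close>, which are 0.

  \<^item> For primitivity, only the multilinear part of a noncommutative polynomial matters. Alternating
    a left-normed commutator of length at least three gives 0 by the Jacobi identity, while
    alternating \<open>s\<^sub>5\<close> multiplies it by \<open>5!\<close>.
\<close>

section \<open>Alternating sums over permutations\<close>

lemma signed_0 [simp]: "signed \<sigma> 0 = 0"
  by (simp add: signed_def)

lemma signed_add: "signed \<sigma> (x + y) = signed \<sigma> x + signed \<sigma> y"
  by (simp add: signed_def)

lemma signed_minus: "signed \<sigma> (- x) = - signed \<sigma> x"
  by (simp add: signed_def)

lemma signed_diff: "signed \<sigma> (x - y) = signed \<sigma> x - signed \<sigma> y"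
  by (simp add: signed_def)

lemma signed_sum: "signed \<sigma> (sum f A) = (\<Sum>x\<in>A. signed \<sigma> (f x))"
  by (simp add: signed_def sum_negf)

lemma signed_id [simp]: "signed id x = x"
  by (simp add: signed_def)

lemma signed_compose:
  "permutation \<sigma> \<Longrightarrow> permutation \<tau> \<Longrightarrow> signed (\<sigma> \<circ> \<tau>) x = signed \<sigma> (signed \<tau> x)"
  by (simp add: signed_def sign_compose) (simp add: sign_def)

lemma signed_signed [simp]: "signed \<sigma> (signed \<sigma> x) = x"
  by (simp add: signed_def)

lemma signed_commute: "signed \<sigma> (signed \<tau> x) = signed \<tau> (signed \<sigma> x)"
  by (simp add: signed_def)

lemma signed_mult_right: "y * signed \<sigma> x = signed \<sigma> (y * x :: 'a :: ring)"
  by (simp add: signed_def)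

lemma signed_apply: "signed \<sigma> F x = signed \<sigma> (F x)"
  by (simp add: signed_def)

lemma signed_transpose: "signed (transpose a b) x = (if a = b then x else - x)" for a b :: nat
  by (simp add: signed_def sign_swap_id)

lemma permutation_lessThan: "\<sigma> permutes {..<n::nat} \<Longrightarrow> permutation \<sigma>"
  by (auto simp: permutation_permutes)

lemma sum_apply: "(\<Sum>x\<in>A. F x) y = (\<Sum>x\<in>A. F x y)"
  by (induction A rule: infinite_finite_induct) auto

text \<open>
  Alternation of an arbitrary function of a list, rather than of a left-normed product, so that an
  alternating sum can be manipulated summand by summand.
\<close>

definition alt_sum :: "('a list \<Rightarrow> 'b::ab_group_add) \<Rightarrow> 'a list \<Rightarrow> 'b" where
  "alt_sum F xs = (\<Sum>\<sigma> | \<sigma> permutes {..<length xs}. signed \<sigma> (F (permute_list \<sigma> xs)))"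

lemma skew_poly_eq_alt_sum: "skew_poly opn = alt_sum (left_normed opn)"
  by (simp add: fun_eq_iff skew_poly_def alt_sum_def)

lemma alt_sum_apply: "alt_sum F xs f = alt_sum (\<lambda>ys. F ys f) xs"
  by (simp add: alt_sum_def sum_apply signed_apply)

lemma alt_sum_map: "alt_sum F (map h xs) = alt_sum (\<lambda>ys. F (map h ys)) xs"
  by (auto simp: alt_sum_def permute_list_map intro!: sum.cong)

lemma alt_sum_cong:
  assumes "\<And>ys. length ys = length xs \<Longrightarrow> mset ys = mset xs \<Longrightarrow> F ys = G ys"
  shows "alt_sum F xs = alt_sum G xs"
  unfolding alt_sum_def using assms by (intro sum.cong) auto

lemma alt_sum_add: "alt_sum (\<lambda>ys. F ys + G ys) xs = alt_sum F xs + alt_sum G xs"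
  by (simp add: alt_sum_def signed_add sum.distrib)

lemma alt_sum_minus: "alt_sum (\<lambda>ys. - F ys) xs = - alt_sum F xs"
  by (simp add: alt_sum_def signed_minus sum_negf)

lemma alt_sum_diff: "alt_sum (\<lambda>ys. F ys - G ys) xs = alt_sum F xs - alt_sum G xs"
  using alt_sum_add[of F "\<lambda>ys. - G ys" xs] by (simp add: alt_sum_minus)

lemma alt_sum_sum: "alt_sum (\<lambda>ys. \<Sum>i\<in>A. F i ys) xs = (\<Sum>i\<in>A. alt_sum (F i) xs)"
  unfolding alt_sum_def signed_sum by (rule sum.swap)

lemma alt_sum_signed: "alt_sum (\<lambda>ys. signed \<sigma> (F ys)) xs = signed \<sigma> (alt_sum F xs)"
  by (simp add: signed_def alt_sum_minus)

lemma alt_sum_additive: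
  assumes "\<And>x y. h (x + y) = h x + h y"
  shows "alt_sum (\<lambda>ys. h (F ys)) xs = h (alt_sum F xs)"
proof -
  have h0: "h 0 = 0" using assms[of 0 0] by simp
  have hm: "h (- x) = - h x" for x
    using assms[of x "- x"] h0 by (simp add: eq_neg_iff_add_eq_0 add.commute)
  have "h (sum f A) = (\<Sum>x\<in>A. h (f x))" for f :: "(nat \<Rightarrow> nat) \<Rightarrow> _" and A
    by (induction A rule: infinite_finite_induct) (auto simp: assms h0)
  then show ?thesis
    unfolding alt_sum_def by (auto simp: signed_def hm intro!: sum.cong)
qed

lemma alt_sum_reindex:
  assumes \<rho>: "\<rho> permutes {..<length xs}"
  shows "alt_sum (\<lambda>ys. F (permute_list \<rho> ys)) xs = signed \<rho> (alt_sum F xs)"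
proof -
  have "alt_sum F xs = (\<Sum>\<sigma> | \<sigma> permutes {..<length xs}.
      signed (\<sigma> \<circ> \<rho>) (F (permute_list (\<sigma> \<circ> \<rho>) xs)))"
    unfolding alt_sum_def by (rule sum_permutations_compose_right[OF \<rho>])
  also have "\<dots> = (\<Sum>\<sigma> | \<sigma> permutes {..<length xs}.
      signed \<rho> (signed \<sigma> (F (permute_list \<rho> (permute_list \<sigma> xs)))))"
    using \<rho> by (intro sum.cong refl)
      (auto simp: signed_compose permutation_lessThan permute_list_compose signed_commute)
  also have "\<dots> = signed \<rho> (alt_sum (\<lambda>ys. F (permute_list \<rho> ys)) xs)"
    by (simp add: alt_sum_def signed_sum)
  finally show ?thesis by simp
qed

lemma alt_sum_permute:
  assumes \<rho>: "\<rho> permutes {..<length xs}"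
  shows "alt_sum F (permute_list \<rho> xs) = signed \<rho> (alt_sum F xs)"
proof -
  have "alt_sum F xs = (\<Sum>\<sigma> | \<sigma> permutes {..<length xs}.
      signed (\<rho> \<circ> \<sigma>) (F (permute_list (\<rho> \<circ> \<sigma>) xs)))"
    unfolding alt_sum_def by (rule setum_permutations_compose_left[OF \<rho>])
  also have "\<dots> = (\<Sum>\<sigma> | \<sigma> permutes {..<length xs}.
      signed \<rho> (signed \<sigma> (F (permute_list \<sigma> (permute_list \<rho> xs)))))"
    using \<rho> by (intro sum.cong refl)
      (auto simp: signed_compose permutation_lessThan permute_list_compose)
  also have "\<dots> = signed \<rho> (alt_sum F (permute_list \<rho> xs))"
    by (simp add: alt_sum_def signed_sum)
  finally show ?thesis by simp
qed

lemma alt_sum_swap_adjacent: "alt_sum F (as @ x # y # bs) = - alt_sum F (as @ y # x # bs)"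
proof -
  define \<rho> where "\<rho> = transpose (length as) (Suc (length as))"
  have \<rho>: "\<rho> permutes {..<length (as @ y # x # bs)}"
    unfolding \<rho>_def by (intro permutes_swap_id) auto
  have "permute_list \<rho> (as @ y # x # bs) = as @ x # y # bs"
  proof (rule nth_equalityI)
    fix i assume "i < length (permute_list \<rho> (as @ y # x # bs))"
    then show "permute_list \<rho> (as @ y # x # bs) ! i = (as @ x # y # bs) ! i"
      using \<rho> by (auto simp: permute_list_nth \<rho>_def transpose_def nth_append nth_Cons')
  qed simp
  then show ?thesis
    using alt_sum_permute[OF \<rho>, of F] by (simp add: signed_def \<rho>_def sign_swap_id)
qed

text \<open>
  Alternating over a subgroup first only repeats the alternating sum, once for each element of the
  subgroup. This replaces most expansions of an alternating sum along one argument: to see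
  that a sum over \<open>Sym\<^sub>n\<close> vanishes, it suffices that some partial sum over \<open>Sym\<^sub>k\<close> vanishes.
\<close>

lemma alt_sum_average:
  assumes "k \<le> length xs"
  shows "alt_sum (\<lambda>ys. \<Sum>\<tau> | \<tau> permutes {..<k}. signed \<tau> (F (permute_list \<tau> ys))) xs
     = (\<Sum>\<tau> | \<tau> permutes {..<k}. alt_sum F xs)"
proof -
  have "alt_sum (\<lambda>ys. signed \<tau> (F (permute_list \<tau> ys))) xs = alt_sum F xs"
    if "\<tau> permutes {..<k}" for \<tau>
  proof -
    have "\<tau> permutes {..<length xs}" using that assms by (auto intro: permutes_subset)
    then show ?thesis by (simp add: alt_sum_signed alt_sum_reindex)
  qed
  then show ?thesis by (simp add: alt_sum_sum)
qed

lemma alt_sum_eq_0_if_block: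
  fixes F :: "'a list \<Rightarrow> 'b::{ring_char_0,semiring_no_zero_divisors}"
  assumes "k \<le> length xs"
    and "\<And>ys. length ys = length xs \<Longrightarrow> mset ys = mset xs \<Longrightarrow>
      (\<Sum>\<tau> | \<tau> permutes {..<k}. signed \<tau> (F (permute_list \<tau> ys))) = 0"
  shows "alt_sum F xs = 0"
proof -
  have "(\<Sum>\<tau> | \<tau> permutes {..<k}. alt_sum F xs) =
     alt_sum (\<lambda>ys. \<Sum>\<tau> | \<tau> permutes {..<k}. signed \<tau> (F (permute_list \<tau> ys))) xs"
    by (rule alt_sum_average[OF assms(1), symmetric])
  also have "\<dots> = alt_sum (\<lambda>_. 0) xs" by (rule alt_sum_cong) (rule assms(2))
  also have "\<dots> = 0" by (simp add: alt_sum_def)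
  finally show ?thesis by (simp add: card_permutations)
qed

lemma sum_const_eq_0:
  assumes "(\<Sum>\<tau> | \<tau> permutes {..<n::nat}. c) = (0 :: 'b :: {ring_char_0, semiring_no_zero_divisors})"
  shows "c = 0"
  using assms by (simp add: card_permutations)

text \<open>
  A permutation moves the entry at a given position to a position that depends on the permutation
  alone; with it, multilinearity passes from a function to its alternating sum.
\<close>

lemma permute_list_slot:
  assumes \<sigma>: "\<sigma> permutes {..<length as + 1 + length bs}"
  obtains cs ds where "\<And>x. permute_list \<sigma> (as @ x # bs) = cs @ x # ds"
proof -
  define n where "n = length as + 1 + length bs"
  define k where "k = inv \<sigma> (length as)"
  have k: "k < n" "\<sigma> k = length as"
    using permutes_in_image[OF permutes_inv[OF \<sigma>], of "length as"] permutes_inverses[OF \<sigma>]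
    by (simp_all add: k_def n_def)
  define L where "L = permute_list \<sigma> (as @ undefined # bs)"
  have "permute_list \<sigma> (as @ x # bs) = L[k := x]" for x
  proof (rule nth_equalityI)
    fix i assume "i < length (permute_list \<sigma> (as @ x # bs))"
    then have i: "i < n" by (simp add: n_def)
    have "\<sigma> i = length as \<longleftrightarrow> i = k"
      using k permutes_inj[OF \<sigma>] by (metis injD)
    then show "permute_list \<sigma> (as @ x # bs) ! i = L[k := x] ! i"
      using i k \<sigma> by (auto simp: L_def permute_list_nth n_def nth_list_update nth_append nth_Cons')
  qed (simp add: L_def)
  moreover have "k < length L" using k by (simp add: L_def n_def)
  ultimately have "permute_list \<sigma> (as @ x # bs) = take k L @ x # drop (Suc k) L" for x
    by (simp add: upd_conv_take_nth_drop)
  then show thesis using that by blast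
qed

lemma alt_sum_slot_add:
  assumes "\<And>cs ds. F (cs @ (a + b) # ds) = F (cs @ a # ds) + F (cs @ b # ds)"
  shows "alt_sum F (as @ (a + b) # bs) = alt_sum F (as @ a # bs) + alt_sum F (as @ b # bs)"
  unfolding alt_sum_def sum.distrib[symmetric] length_append list.size add_Suc_right add_0_right
proof (intro sum.cong refl)
  fix \<sigma> :: "nat \<Rightarrow> nat" assume "\<sigma> \<in> {\<sigma>. \<sigma> permutes {..<Suc (length as + length bs)}}"
  then have "\<sigma> permutes {..<length as + 1 + length bs}" by simp
  then obtain cs ds where "\<And>x. permute_list \<sigma> (as @ x # bs) = cs @ x # ds"
    by (rule permute_list_slot) blast
  then show "signed \<sigma> (F (permute_list \<sigma> (as @ (a + b) # bs))) =
     signed \<sigma> (F (permute_list \<sigma> (as @ a # bs))) + signed \<sigma> (F (permute_list \<sigma> (as @ b # bs)))"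
    by (simp add: assms signed_add)
qed

lemma alt_sum_slot_scale:
  assumes "\<And>cs ds. F (cs @ g a # ds) = h (F (cs @ a # ds))" "\<And>x y. h (x + y) = h x + h y"
  shows "alt_sum F (as @ g a # bs) = h (alt_sum F (as @ a # bs))"
  unfolding alt_sum_additive[of h, OF assms(2), symmetric]
  unfolding alt_sum_def length_append list.size add_Suc_right add_0_right
proof (intro sum.cong refl)
  fix \<sigma> :: "nat \<Rightarrow> nat" assume "\<sigma> \<in> {\<sigma>. \<sigma> permutes {..<Suc (length as + length bs)}}"
  then have "\<sigma> permutes {..<length as + 1 + length bs}" by simp
  then obtain cs ds where "\<And>x. permute_list \<sigma> (as @ x # bs) = cs @ x # ds"
    by (rule permute_list_slot) blast
  then show "signed \<sigma> (F (permute_list \<sigma> (as @ g a # bs))) =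
     signed \<sigma> (h (F (permute_list \<sigma> (as @ a # bs))))"
    by (simp add: assms)
qed

lemma permute_list_snoc:
  assumes "\<tau> permutes {..<length xs}"
  shows "permute_list \<tau> (xs @ ys) = permute_list \<tau> xs @ ys"
proof (rule nth_equalityI)
  fix i assume "i < length (permute_list \<tau> (xs @ ys))"
  moreover have "\<tau> permutes {..<length (xs @ ys)}"
    using assms by (rule permutes_subset) auto
  moreover have "\<tau> i = i" if "i \<ge> length xs" using assms that by (auto simp: permutes_def)
  moreover have "\<tau> i < length xs" if "i < length xs" using permutes_in_image[OF assms] that by auto
  ultimately show "permute_list \<tau> (xs @ ys) ! i = (permute_list \<tau> xs @ ys) ! i"
    using assms by (auto simp: permute_list_nth nth_append)
qed simp

text \<open>
  If \<open>F\<close> is already skew in the first \<open>n\<close> arguments, only the \<open>n + 1\<close> cosets of \<open>Sym\<^sub>n\<close> in \<open>Sym\<^sub>n\<^sub>+\<^sub>1\<close>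
  contribute distinct values; they are represented by the transpositions of the last position.
\<close>

lemma alt_sum_cosets:
  assumes xs: "length xs = Suc n"
    and inv: "\<And>\<tau> ys. \<tau> permutes {..<n} \<Longrightarrow> length ys = Suc n \<Longrightarrow> F (permute_list \<tau> ys) = signed \<tau> (F ys)"
  shows "alt_sum F xs = (\<Sum>\<tau> | \<tau> permutes {..<n}. \<Sum>b\<le>n.
    signed (transpose n b) (F (permute_list (transpose n b) xs)))"
proof -
  have ins: "{..<Suc n} = insert n {..<n}" by auto
  have "alt_sum F xs = (\<Sum>b\<in>insert n {..<n}. \<Sum>\<tau> | \<tau> permutes {..<n}.
    signed (transpose n b \<circ> \<tau>) (F (permute_list (transpose n b \<circ> \<tau>) xs)))"
    unfolding alt_sum_def xs ins by (rule sum_over_permutations_insert) auto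
  also have "\<dots> = (\<Sum>b\<in>insert n {..<n}. \<Sum>\<tau> | \<tau> permutes {..<n}.
    signed (transpose n b) (F (permute_list (transpose n b) xs)))"
  proof (intro sum.cong refl)
    fix b \<tau> assume b: "b \<in> insert n {..<n}" and "\<tau> \<in> {\<tau>. \<tau> permutes {..<n}}"
    then have \<tau>: "\<tau> permutes {..<n}" by simp
    have t: "transpose n b permutes {..<Suc n}" using b by (intro permutes_swap_id) auto
    have \<tau>': "\<tau> permutes {..<Suc n}" using \<tau> by (rule permutes_subset) auto
    show "signed (transpose n b \<circ> \<tau>) (F (permute_list (transpose n b \<circ> \<tau>) xs)) =
      signed (transpose n b) (F (permute_list (transpose n b) xs))"
      using \<tau> xs permute_list_compose[of \<tau> xs "transpose n b"] \<tau>'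
      by (simp add: inv signed_compose[OF permutation_lessThan[OF t] permutation_lessThan[OF \<tau>']])
  qed
  also have "insert n {..<n} = {..n}" by auto
  finally show ?thesis by (simp add: sum.swap[of _ "{..n}"])
qed

lemma upt_5: "[0..<5] = [0, 1, 2, 3, 4::nat]" and upt_6: "[0..<6] = [0, 1, 2, 3, 4, 5::nat]"
  by (simp_all add: upt_rec)

text \<open>
  The sums of the cocycle condition run over such cosets, written out explicitly.
\<close>

lemma alt_sum_cosets_5:
  assumes "\<And>\<tau> ys. \<tau> permutes {..<4} \<Longrightarrow> length ys = 5 \<Longrightarrow> F (permute_list \<tau> ys) = signed \<tau> (F ys)"
  shows "alt_sum F [a, b, c, d, e] = (\<Sum>\<tau> | \<tau> permutes {..<4::nat}. F [a, b, c, d, e] - F [e, b, c, d, a]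
    - F [a, e, c, d, b] - F [a, b, e, d, c] - F [a, b, c, e, d])"
proof -
  have le: "{..4} = {0, 1, 2, 3, 4::nat}" by auto
  have perm: "permute_list \<sigma> [a, b, c, d, e] = map (\<lambda>i. [a, b, c, d, e] ! \<sigma> i) [0, 1, 2, 3, 4]" for \<sigma>
  proof -
    have "length [a, b, c, d, e] = 5" by simp
    then show ?thesis by (simp only: permute_list_def upt_5)
  qed
  have "alt_sum F [a, b, c, d, e] = (\<Sum>\<tau> | \<tau> permutes {..<4::nat}. \<Sum>i\<le>4.
    signed (transpose 4 i) (F (permute_list (transpose 4 i) [a, b, c, d, e])))"
    by (rule alt_sum_cosets) (simp_all add: assms)
  then show ?thesis by (simp add: le perm signed_transpose transpose_def algebra_simps)
qed

lemma alt_sum_cosets_6: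
  assumes "\<And>\<tau> ys. \<tau> permutes {..<5} \<Longrightarrow> length ys = 6 \<Longrightarrow> F (permute_list \<tau> ys) = signed \<tau> (F ys)"
  shows "alt_sum F [a, b, c, d, e, g] = (\<Sum>\<tau> | \<tau> permutes {..<5::nat}. F [a, b, c, d, e, g] - F [g, b, c, d, e, a]
    - F [a, g, c, d, e, b] - F [a, b, g, d, e, c] - F [a, b, c, g, e, d] - F [a, b, c, d, g, e])"
proof -
  have le: "{..5} = {0, 1, 2, 3, 4, 5::nat}" by auto
  have perm: "permute_list \<sigma> [a, b, c, d, e, g] = map (\<lambda>i. [a, b, c, d, e, g] ! \<sigma> i) [0, 1, 2, 3, 4, 5]" for \<sigma>
  proof -
    have "length [a, b, c, d, e, g] = 6" by simp
    then show ?thesis by (simp only: permute_list_def upt_6)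
  qed
  have "alt_sum F [a, b, c, d, e, g] = (\<Sum>\<tau> | \<tau> permutes {..<5::nat}. \<Sum>i\<le>5.
    signed (transpose 5 i) (F (permute_list (transpose 5 i) [a, b, c, d, e, g])))"
    by (rule alt_sum_cosets) (simp_all add: assms)
  then show ?thesis by (simp add: le perm signed_transpose transpose_def algebra_simps)
qed

lemma map_nth_permutation:
  assumes "mset v = mset [0..<n]"
  obtains \<rho> where "\<rho> permutes {..<n}" "\<And>xs :: 'a list. length xs = n \<Longrightarrow> map ((!) xs) v = permute_list \<rho> xs"
proof -
  obtain \<rho> where \<rho>: "\<rho> permutes {..<length [0..<n]}" "permute_list \<rho> [0..<n] = v"
    using mset_eq_permutation[OF assms] by blast
  have "map ((!) xs) v = permute_list \<rho> xs" if "length xs = n" for xs :: "'a list"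
    using that \<rho> permute_list_map[of \<rho> "[0..<n]" "(!) xs"] by (auto simp: map_nth)
  then show thesis using that \<rho> by auto
qed

section \<open>Partial derivatives of polynomials in two variables\<close>

lemma d1_add: "d1 (p + q) = d1 p + d1 q"
  by (simp add: d1_def poly_eq_iff coeff_map_poly pderiv_add)

lemma d2_add: "d2 (p + q) = d2 p + d2 q"
  by (simp add: d2_def pderiv_add)

lemma d1_d2: "d2 (d1 p) = d1 (d2 p)"
  by (rule poly_eqI) (simp add: d1_def d2_def coeff_map_poly coeff_pderiv pderiv_mult pderiv_add pderiv_smult
      del: of_nat_Suc flip: of_nat_poly)

lemma pderiv_sum: "pderiv (\<Sum>x\<in>A. f x) = (\<Sum>x\<in>A. pderiv (f x))"
  by (induction A rule: infinite_finite_induct) (auto simp: pderiv_add)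

lemma d1_mult: "d1 (p * q) = d1 p * q + p * d1 q"
  by (rule poly_eqI)
    (simp add: d1_def coeff_map_poly coeff_mult pderiv_sum pderiv_mult sum.distrib mult.commute[of "pderiv _"])

lemma d2_mult: "d2 (p * q) = d2 p * q + p * d2 q"
  by (simp add: d2_def pderiv_mult algebra_simps)

text \<open>
  Complex scalars as elements of \<open>U\<close>. As a separate constant they stay factors of products, whereas
  the simplifier would turn the polynomial \<open>[:[:c:]:]\<close> into scalar multiplications.
\<close>

definition const :: "complex \<Rightarrow> U" where "const c = [:[:c:]:]"

lemma const_mult: "const a * const b = const (a * b)"
  by (simp add: const_def)

lemma const_mult_mult [simp]: "const a * (const b * p) = const (a * b) * p"
  by (simp add: const_mult flip: mult.assoc)

lemma const_1 [simp]: "const 1 = 1"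
  by (simp add: const_def one_pCons)

lemma const_of_nat: "const (of_nat n) = of_nat n"
  by (simp add: const_def of_nat_poly)

lemma cscale_apply: "cscale c X f = const c * X f"
  by (simp add: cscale_def const_def)

lemma d1_const: "d1 (const c * p) = const c * d1 p"
  by (rule poly_eqI) (simp add: const_def d1_def coeff_map_poly pderiv_smult)

lemma d2_const: "d2 (const c * p) = const c * d2 p"
  by (simp add: const_def d2_def pderiv_smult)

lemma d1_0 [simp]: "d1 0 = 0" and d2_0 [simp]: "d2 0 = 0"
  by (simp_all add: d1_def d2_def)

lemma d1_minus: "d1 (- p) = - d1 p" and d2_minus: "d2 (- p) = - d2 p"
  using d1_add[of p "- p"] d2_add[of p "- p"] by (simp_all add: eq_neg_iff_add_eq_0 add.commute)

lemma d1_diff: "d1 (p - q) = d1 p - d1 q" and d2_diff: "d2 (p - q) = d2 p - d2 q"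
  using d1_add[of p "- q"] d2_add[of p "- q"] by (simp_all add: d1_minus d2_minus)

definition jet :: "nat \<Rightarrow> nat \<Rightarrow> U \<Rightarrow> U" where
  "jet i j u = (d1 ^^ i) ((d2 ^^ j) u)"

lemma d1_jet: "d1 (jet i j u) = jet (Suc i) j u"
  by (simp add: jet_def)

lemma d2_jet: "d2 (jet i j u) = jet i (Suc j) u"
proof -
  have "d2 ((d1 ^^ i) p) = (d1 ^^ i) (d2 p)" for p
    by (induction i) (simp_all add: d1_d2)
  then show ?thesis by (simp add: jet_def)
qed

lemma jet_add: "jet i j (x + y) = jet i j x + jet i j y"
proof -
  have 2: "(d2 ^^ j) (x + y) = (d2 ^^ j) x + (d2 ^^ j) y" for x y
    by (induction j) (simp_all add: d2_add)
  have 1: "(d1 ^^ i) (x + y) = (d1 ^^ i) x + (d1 ^^ i) y" for x y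
    by (induction i) (simp_all add: d1_add)
  show ?thesis by (simp add: jet_def 1 2)
qed

lemma jet_const: "jet i j (const c * x) = const c * jet i j x"
proof -
  have 2: "(d2 ^^ j) (const c * x) = const c * (d2 ^^ j) x" for x
    by (induction j) (simp_all add: d2_const)
  have 1: "(d1 ^^ i) (const c * x) = const c * (d1 ^^ i) x" for x
    by (induction i) (simp_all add: d1_const)
  show ?thesis by (simp add: jet_def 1 2)
qed

section \<open>Calculus with anticommuting jets\<close>

text \<open>
  The Grassmann calculus is axiomatised through operators, which avoids having to construct a
  Grassmann algebra: \<open>M i j\<close> stands for multiplication by the odd jet \<open>u\<^sub>i\<^sub>j\<close>, and \<open>dx\<close>, \<open>dy\<close> are even derivations.
\<close>

locale odd_jets =
  fixes M :: "nat \<Rightarrow> nat \<Rightarrow> 'g::ab_group_add \<Rightarrow> 'g"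
    and dx dy :: "'g \<Rightarrow> 'g"
  assumes M_add: "M i j (g + h) = M i j g + M i j h"
    and dx_add: "dx (g + h) = dx g + dx h"
    and dy_add: "dy (g + h) = dy g + dy h"
    and dy_dx: "dy (dx g) = dx (dy g)"
    and dx_M: "dx (M i j g) = M (Suc i) j g + M i j (dx g)"
    and dy_M: "dy (M i j g) = M i (Suc j) g + M i j (dy g)"
    and M_anticomm: "M i j (M k l g) = - M k l (M i j g)"
    and M_square: "M i j (M i j g) = 0"
begin

lemma M_0 [simp]: "M i j 0 = 0"
  using M_add[of i j 0 0] by simp

lemma M_minus: "M i j (- g) = - M i j g"
  using M_add[of i j g "- g"] by (simp add: eq_neg_iff_add_eq_0 add.commute)

lemma dx_minus: "dx (- g) = - dx g"
  using dx_add[of g "- g"] dx_add[of 0 0] by (simp add: eq_neg_iff_add_eq_0 add.commute)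

lemma dy_minus: "dy (- g) = - dy g"
  using dy_add[of g "- g"] dy_add[of 0 0] by (simp add: eq_neg_iff_add_eq_0 add.commute)

lemma M_diff: "M i j (g - h) = M i j g - M i j h"
  using M_add[of i j g "- h"] by (simp add: M_minus)

lemma dx_diff: "dx (g - h) = dx g - dx h"
  using dx_add[of g "- h"] by (simp add: dx_minus)

lemma dy_diff: "dy (g - h) = dy g - dy h"
  using dy_add[of g "- h"] by (simp add: dy_minus)

text \<open>
  Anticommutation is used as a rewrite rule in one direction only: the simplifier then sorts the words
  of odd jets, so that equal jets become neighbours and cancel by \<open>M_square\<close>.
\<close>

lemma M_sort: "i > k \<or> i = k \<and> j > l \<Longrightarrow> M i j (M k l g) = - M k l (M i j g)"
  by (rule M_anticomm)

lemmas jet_rules = M_add dx_add dy_add M_minus dx_minus dy_minus M_diff dx_diff dy_diff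
  dx_M dy_M dy_dx M_sort M_square

text \<open>
  The Hamiltonian field \<open>{u, _}\<close> of the odd Hamiltonian \<open>u\<close>.
\<close>

definition ham_odd :: "'g \<Rightarrow> 'g" where
  "ham_odd g = M 1 0 (dy g) - M 0 1 (dx g)"

text \<open>
  The product of all jets of order one and two, in an order for which \<open>ham_odd_5\<close> needs no sign.
\<close>

definition jet_word :: "'g \<Rightarrow> 'g" where
  "jet_word g = M 0 1 (M 0 2 (M 1 0 (M 1 1 (M 2 0 g))))"

text \<open>
  After sorting, every remaining word consists of four of the jets in \<open>jet_word\<close> and one jet of order
  three, and is followed by a first derivative of \<open>g\<close>; on the right-hand side the second derivatives
  of \<open>g\<close> cancel. An abelian group has no scalars, hence the factor 3 as a repeated sum.
\<close>

lemma ham_odd_5: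
  "ham_odd (ham_odd (ham_odd (ham_odd (ham_odd g)))) =
   dx (jet_word (dy g)) + dx (jet_word (dy g)) + dx (jet_word (dy g))
   - dy (jet_word (dx g)) - dy (jet_word (dx g)) - dy (jet_word (dx g))"
  by (simp add: ham_odd_def jet_word_def jet_rules eval_nat_numeral algebra_simps)

lemma ham_odd_6: "ham_odd (ham_odd (ham_odd (ham_odd (ham_odd (ham_odd g))))) = 0"
  unfolding ham_odd_5 by (simp add: ham_odd_def jet_word_def jet_rules eval_nat_numeral algebra_simps)

definition M_word :: "(nat \<times> nat) list \<Rightarrow> 'g \<Rightarrow> 'g" where
  "M_word w = fold (\<lambda>(i, j). M i j) w"

definition deriv :: "nat \<times> nat \<Rightarrow> 'g \<Rightarrow> 'g" where
  "deriv p g = (dx ^^ fst p) ((dy ^^ snd p) g)"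

lemma M_word_0: "M_word w 0 = 0"
  by (induction w) (auto simp: M_word_def)

lemma M_word_add: "M_word w (g + h) = M_word w g + M_word w h"
  by (induction w arbitrary: g h) (auto simp: M_word_def M_add)

lemma M_word_minus: "M_word w (- g) = - M_word w g"
  by (induction w arbitrary: g) (auto simp: M_word_def M_minus)

lemma M_word_M_eq_0: "(i, j) \<in> set w \<Longrightarrow> M_word w (M i j g) = 0"
proof (induction w arbitrary: g)
  case (Cons q w)
  obtain k l where q: "q = (k, l)" by fastforce
  show ?case
  proof (cases "(i, j) = (k, l)")
    case True
    then show ?thesis using q M_word_0 by (simp add: M_word_def M_square)
  next
    case False
    then have "M_word w (M i j (M k l g)) = 0" using Cons q by auto
    then show ?thesis
      using q M_word_minus[of w "M i j (M k l g)"] by (simp add: M_word_def M_anticomm[of k l i j g])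
  qed
qed simp

text \<open>
  Sums of words with at least \<open>n\<close> odd factors from \<open>S\<close>. A derivation replaces one factor of each word
  at a time, so it lowers this count by at most one, whereas a word that contains all of \<open>S\<close>
  annihilates everything with a positive count.
\<close>

inductive many_factors :: "(nat \<times> nat) set \<Rightarrow> nat \<Rightarrow> 'g \<Rightarrow> bool" for S where
  none: "many_factors S 0 g"
| one_more: "(i, j) \<in> S \<Longrightarrow> many_factors S n g \<Longrightarrow> many_factors S (Suc n) (M i j g)"
| any: "many_factors S n g \<Longrightarrow> many_factors S n (M i j g)"
| add: "many_factors S n g \<Longrightarrow> many_factors S n h \<Longrightarrow> many_factors S n (g + h)"

lemma many_factors_mono: "many_factors S n g \<Longrightarrow> m \<le> n \<Longrightarrow> many_factors S m g"
proof (induction arbitrary: m rule: many_factors.induct)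
  case (one_more i j n g)
  then show ?case by (cases m) (auto intro: many_factors.intros)
qed (auto intro: many_factors.intros)

lemma many_factors_dx: "many_factors S n g \<Longrightarrow> many_factors S (n - 1) (dx g)"
proof (induction rule: many_factors.induct)
  case (one_more i j n g)
  then have "many_factors S n (M i j (dx g))"
    by (cases n) (auto intro: many_factors.intros)
  then show ?case using one_more by (auto simp: dx_M intro: many_factors.intros)
next
  case (any n g i j)
  then show ?case using many_factors_mono[OF any(1), of "n - 1"] by (auto simp: dx_M intro: many_factors.intros)
qed (auto simp: dx_add intro: many_factors.intros)

lemma many_factors_dy: "many_factors S n g \<Longrightarrow> many_factors S (n - 1) (dy g)"
proof (induction rule: many_factors.induct)
  case (one_more i j n g)
  then have "many_factors S n (M i j (dy g))"
    by (cases n) (auto intro: many_factors.intros)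
  then show ?case using one_more by (auto simp: dy_M intro: many_factors.intros)
next
  case (any n g i j)
  then show ?case using many_factors_mono[OF any(1), of "n - 1"] by (auto simp: dy_M intro: many_factors.intros)
qed (auto simp: dy_add intro: many_factors.intros)

lemma many_factors_deriv:
  assumes "many_factors S n g"
  shows "many_factors S (n - (i + j)) (deriv (i, j) g)"
proof -
  have y: "many_factors S (n - j) ((dy ^^ j) g)"
  proof (induction j)
    case (Suc j)
    from many_factors_dy[OF Suc] show ?case by (simp add: diff_diff_left)
  qed (simp add: assms)
  have "many_factors S (n - j - i) ((dx ^^ i) ((dy ^^ j) g))"
  proof (induction i)
    case (Suc i)
    from many_factors_dx[OF Suc] show ?case by (simp add: diff_diff_left)
  qed (simp add: y)
  then show ?thesis by (simp add: deriv_def add.commute)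
qed

lemma many_factors_M_word:
  assumes "distinct w" "many_factors S n g"
  shows "many_factors S (n + card (set w \<inter> S)) (M_word w g)"
  using assms
proof (induction w arbitrary: n g)
  case (Cons q w)
  obtain k l where q: "q = (k, l)" by fastforce
  show ?case
  proof (cases "q \<in> S")
    case True
    then have "many_factors S (Suc n) (M k l g)" using Cons q by (auto intro: many_factors.intros)
    then have "many_factors S (Suc n + card (set w \<inter> S)) (M_word w (M k l g))"
      using Cons.IH[of "Suc n"] Cons.prems by simp
    then show ?thesis using True Cons q by (simp add: M_word_def)
  next
    case False
    then have "many_factors S n (M k l g)" using Cons q by (auto intro: many_factors.intros)
    then have "many_factors S (n + card (set w \<inter> S)) (M_word w (M k l g))"
      using Cons by auto
    then show ?thesis using False Cons q by (simp add: M_word_def)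
  qed
qed (simp add: M_word_def)

lemma M_word_many_eq_0:
  assumes "many_factors S n g" "n > 0" "S \<subseteq> set w"
  shows "M_word w g = 0"
  using assms
proof (induction rule: many_factors.induct)
  case (one_more i j n g)
  then show ?case using M_word_M_eq_0[of i j w g] by auto
next
  case (any n g i j)
  \<comment> \<open>a factor outside \<open>S\<close> moves past \<open>w\<close>, with a sign that depends on the length of \<open>w\<close>\<close>
  have "M_word w (M i j g) = M_word (w @ [(i, j)]) g \<or> M_word w (M i j g) = - M_word (w @ [(i, j)]) g"
  proof (induction w arbitrary: g)
    case (Cons q w)
    obtain k l where q: "q = (k, l)" by fastforce
    show ?case
      using Cons[of "M k l g"] q M_word_minus[of w "M i j (M k l g)"]
      by (auto simp: M_word_def M_anticomm[of k l i j g])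
  qed (simp add: M_word_def)
  moreover have "M_word (w @ [(i, j)]) g = 0" using any by (simp add: M_word_def)
  ultimately show ?case by auto
qed (auto simp: M_word_add)

text \<open>
  The pigeonhole principle: \<open>w\<close> and \<open>w'\<close> share more than \<open>i + j\<close> jets, and a derivative of order
  \<open>i + j\<close> can replace at most \<open>i + j\<close> of the shared ones.
\<close>

lemma M_word_deriv_M_word_eq_0:
  assumes "distinct w" "distinct w'" "set w \<subseteq> J" "set w' \<subseteq> J" "finite J"
    and "length w + length w' > card J + (i + j)"
  shows "M_word w (deriv (i, j) (M_word w' g)) = 0"
proof -
  have "length w + length w' = card (set w \<union> set w') + card (set w \<inter> set w')"
    using card_Un_Int[of "set w" "set w'"] assms(1,2) by (simp add: distinct_card)
  moreover have "card (set w \<union> set w') \<le> card J"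
    using assms by (intro card_mono) auto
  ultimately have "card (set w' \<inter> set w) > i + j"
    using assms by (simp add: Int_commute)
  moreover have "many_factors (set w) (card (set w' \<inter> set w) - (i + j)) (deriv (i, j) (M_word w' g))"
    using many_factors_deriv[OF many_factors_M_word[OF assms(2) many_factors.none[of "set w" g]]] by simp
  ultimately show ?thesis
    by (intro M_word_many_eq_0) auto
qed

end

section \<open>Realisation by alternating functions\<close>

text \<open>
  Normalised by \<open>n!\<close>, alternation is idempotent, and wedge products defined with it
  satisfy the rules of the jet calculus without numerical factors.
\<close>

definition alt_mean :: "('a list \<Rightarrow> U) \<Rightarrow> 'a list \<Rightarrow> U" where
  "alt_mean F xs = const (1 / fact (length xs)) * alt_sum F xs"

lemma fact_alt_mean: "const (fact (length xs)) * alt_mean F xs = alt_sum F xs"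
  by (simp add: alt_mean_def)

lemma alt_mean_cong:
  assumes "\<And>ys. length ys = length xs \<Longrightarrow> mset ys = mset xs \<Longrightarrow> F ys = G ys"
  shows "alt_mean F xs = alt_mean G xs"
  using alt_sum_cong[of xs F G, OF assms] by (simp add: alt_mean_def)

lemma alt_mean_add: "alt_mean (\<lambda>ys. F ys + G ys) xs = alt_mean F xs + alt_mean G xs"
  unfolding alt_mean_def alt_sum_add by (rule distrib_left)

lemma alt_mean_additive:
  assumes "\<And>x y. h (x + y) = h x + h y" "\<And>c x. h (const c * x) = const c * h x"
  shows "alt_mean (\<lambda>ys. h (F ys)) xs = h (alt_mean F xs)"
  unfolding alt_mean_def assms(2) by (subst alt_sum_additive) (simp_all add: assms)

lemma alt_mean_average:
  assumes "k \<le> length xs"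
  shows "alt_mean (\<lambda>ys. const (1 / fact k) * (\<Sum>\<tau> | \<tau> permutes {..<k}. signed \<tau> (F (permute_list \<tau> ys)))) xs
     = alt_mean F xs"
proof -
  have "alt_mean (\<lambda>ys. const (1 / fact k) * (\<Sum>\<tau> | \<tau> permutes {..<k}. signed \<tau> (F (permute_list \<tau> ys)))) xs
    = const (1 / fact (length xs)) * (const (1 / fact k) * alt_sum (\<lambda>ys.
        (\<Sum>\<tau> | \<tau> permutes {..<k}. signed \<tau> (F (permute_list \<tau> ys)))) xs)"
    unfolding alt_mean_def by (subst alt_sum_additive) (simp_all add: ring_distribs)
  also have "\<dots> = const (1 / fact (length xs)) * (const (1 / fact k) * (const (fact k) * alt_sum F xs))"
    using assms const_of_nat[of "fact k"] by (subst alt_sum_average) (simp_all add: card_permutations)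
  also have "\<dots> = const (1 / fact (length xs)) * alt_sum F xs"
    by simp
  finally show ?thesis by (simp add: alt_mean_def)
qed

text \<open>
  Alternating an initial block of the arguments is absorbed by the alternation of all arguments:
  this is associativity of the wedge product, and the reason why iterated constructions below are
  equal to a single alternation of the obvious function.
\<close>

lemma alt_mean_block:
  assumes H: "\<And>x y zs. H (x + y) zs = H x zs + H y zs" "\<And>c x zs. H (const c * x) zs = const c * H x zs"
    and k: "k \<le> length xs"
  shows "alt_mean (\<lambda>ys. H (alt_mean F (take k ys)) (drop k ys)) xs = alt_mean (\<lambda>ys. H (F (take k ys)) (drop k ys)) xs"
proof -
  have H0: "H 0 zs = 0" for zs using H(1)[of 0 0] by simp
  have Hm: "H (- x) zs = - H x zs" for x zs
    using H(1)[of x "- x" zs] H0 by (simp add: eq_neg_iff_add_eq_0 add.commute)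
  have Hs: "H (sum f A) zs = (\<Sum>x\<in>A. H (f x) zs)" for f :: "(nat \<Rightarrow> nat) \<Rightarrow> _" and A zs
    by (induction A rule: infinite_finite_induct) (auto simp: H H0)
  have "alt_mean (\<lambda>ys. H (alt_mean F (take k ys)) (drop k ys)) xs =
      alt_mean (\<lambda>ys. const (1 / fact k) * (\<Sum>\<tau> | \<tau> permutes {..<k}. signed \<tau>
        ((\<lambda>ys. H (F (take k ys)) (drop k ys)) (permute_list \<tau> ys)))) xs"
  proof (rule alt_mean_cong)
    fix ys :: "'a list" assume "length ys = length xs"
    then have len: "length (take k ys) = k" using k by simp
    have p: "permute_list \<tau> ys = permute_list \<tau> (take k ys) @ drop k ys" if "\<tau> permutes {..<k}" for \<tau>
      using permute_list_snoc[of \<tau> "take k ys" "drop k ys"] that len by simp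
    have "H (alt_mean F (take k ys)) (drop k ys) = const (1 / fact k) *
       (\<Sum>\<tau> | \<tau> permutes {..<k}. H (signed \<tau> (F (permute_list \<tau> (take k ys)))) (drop k ys))"
      unfolding alt_mean_def alt_sum_def len using H(2) by (simp add: Hs)
    also have "(\<Sum>\<tau> | \<tau> permutes {..<k}. H (signed \<tau> (F (permute_list \<tau> (take k ys)))) (drop k ys))
       = (\<Sum>\<tau> | \<tau> permutes {..<k}. signed \<tau> ((\<lambda>ys. H (F (take k ys)) (drop k ys)) (permute_list \<tau> ys)))"
      using len by (intro sum.cong refl) (auto simp: signed_def Hm p)
    finally show "H (alt_mean F (take k ys)) (drop k ys) = const (1 / fact k) *
       (\<Sum>\<tau> | \<tau> permutes {..<k}. signed \<tau> ((\<lambda>ys. H (F (take k ys)) (drop k ys)) (permute_list \<tau> ys)))" .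
  qed
  also have "\<dots> = alt_mean (\<lambda>ys. H (F (take k ys)) (drop k ys)) xs"
    by (rule alt_mean_average[OF k])
  finally show ?thesis .
qed

text \<open>
  The last argument acts by \<open>B\<close> on the value of \<open>F\<close> at the others. With \<open>B\<close> multiplication by a jet
  this is a tensor product; with \<open>B g u = {u, g}\<close> it is the next step of a product of Hamiltonian fields.
  On the empty list, where no argument is left to act, the value 0 is a default.
\<close>

definition app_last :: "(U \<Rightarrow> 'a \<Rightarrow> U) \<Rightarrow> ('a list \<Rightarrow> U) \<Rightarrow> 'a list \<Rightarrow> U" where
  "app_last B F xs = (if xs = [] then 0 else B (F (butlast xs)) (last xs))"

lemma alt_mean_app_last:
  assumes B: "\<And>x y u. B (x + y) u = B x u + B y u" "\<And>c x u. B (const c * x) u = const c * B x u"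
  shows "alt_mean (app_last B (alt_mean F)) xs = alt_mean (app_last B F) xs"
proof (cases "xs = []")
  case False
  define k where "k = length xs - 1"
  have app_last: "app_last B F ys = B (F (take k ys)) (hd (drop k ys))" if "length ys = length xs" for F ys
    using that False by (cases ys rule: rev_cases) (auto simp: app_last_def k_def)
  have "alt_mean (app_last B (alt_mean F)) xs = alt_mean (\<lambda>ys. B (alt_mean F (take k ys)) (hd (drop k ys))) xs"
    by (intro alt_mean_cong app_last)
  also have "\<dots> = alt_mean (\<lambda>ys. B (F (take k ys)) (hd (drop k ys))) xs"
    using alt_mean_block[where H = "\<lambda>x zs. B x (hd zs)" and k = k] B by (simp add: k_def)
  also have "\<dots> = alt_mean (app_last B F) xs"
    by (intro alt_mean_cong app_last[symmetric])
  finally show ?thesis .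
qed (simp add: app_last_def alt_mean_def alt_sum_def)

lemma alt_mean_mult_alt_mean:
  "alt_mean (app_last (\<lambda>g u. g * (b u :: U)) (alt_mean F)) xs = alt_mean (app_last (\<lambda>g u. g * b u) F) xs"
  by (rule alt_mean_app_last) (simp_all add: ring_distribs mult.assoc)

text \<open>
  Multiplication by the odd jet \<open>u\<^sub>i\<^sub>j\<close>: functions of \<open>k\<close> arguments, read as skew forms, become
  functions of \<open>k + 1\<close> arguments.
\<close>

definition wedge :: "nat \<Rightarrow> nat \<Rightarrow> (U list \<Rightarrow> U) \<Rightarrow> U list \<Rightarrow> U" where
  "wedge i j F = alt_mean (app_last (\<lambda>g u. g * jet i j u) F)"

definition fun_d1 :: "(U list \<Rightarrow> U) \<Rightarrow> U list \<Rightarrow> U" where "fun_d1 F us = d1 (F us)"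

definition fun_d2 :: "(U list \<Rightarrow> U) \<Rightarrow> U list \<Rightarrow> U" where "fun_d2 F us = d2 (F us)"

lemma wedge_wedge:
  "wedge i j (wedge k l F) us = alt_mean (app_last (\<lambda>g u. g * jet i j u) (app_last (\<lambda>g u. g * jet k l u) F)) us"
  by (simp add: wedge_def alt_mean_mult_alt_mean)

text \<open>
  Both sides alternate the same function up to the exchange of the last two arguments.
\<close>

lemma wedge_anticomm: "wedge i j (wedge k l F) us = - wedge k l (wedge i j F) us"
proof -
  define n where "n = length us"
  define T where "T = (\<lambda>i j k l. app_last (\<lambda>g u. g * jet i j u) (app_last (\<lambda>g u. g * jet k l u) F))"
  show ?thesis
  proof (cases "n \<ge> 2")
    case True
    define \<rho> where "\<rho> = transpose (n - 2) (n - 1)"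
    have \<rho>: "\<rho> permutes {..<length us}"
      using True by (auto simp: \<rho>_def n_def intro!: permutes_swap_id)
    have sg: "signed \<rho> x = - x" for x :: U
      using True by (simp add: signed_def \<rho>_def sign_swap_id)
    have "alt_sum (T i j k l) us = alt_sum (\<lambda>ys. T k l i j (permute_list \<rho> ys)) us"
    proof (rule alt_sum_cong)
      fix ys :: "U list" assume len: "length ys = length us"
      obtain zs a b where ys: "ys = zs @ [a, b]"
      proof -
        have "ys \<noteq> []" "butlast ys \<noteq> []" using len True by (auto simp: n_def dest!: arg_cong[of _ _ length])
        then have "ys = butlast (butlast ys) @ [last (butlast ys), last ys]"
          by (metis append.assoc append_Cons append_Nil append_butlast_last_id)
        then show ?thesis using that by blast
      qed
      have "permute_list \<rho> ys = zs @ [b, a]"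
      proof (rule nth_equalityI)
        fix q assume "q < length (permute_list \<rho> ys)"
        then have q: "q < length zs + 2" using ys by simp
        have "\<rho> permutes {..<length ys}" using \<rho> len by simp
        moreover have "n = length zs + 2" using len ys by (simp add: n_def)
        ultimately show "permute_list \<rho> ys ! q = (zs @ [b, a]) ! q"
          using q ys by (auto simp: permute_list_nth \<rho>_def transpose_def nth_append less_Suc_eq)
      qed (simp add: ys)
      then show "T i j k l ys = T k l i j (permute_list \<rho> ys)"
        by (simp add: T_def app_last_def ys butlast_append mult_ac)
    qed
    also have "\<dots> = - alt_sum (T k l i j) us"
      by (simp add: alt_sum_reindex[OF \<rho>] sg)
    finally show ?thesis by (simp add: wedge_wedge alt_mean_def T_def)
  next
    case False
    then have "alt_mean (T i j k l) us = 0" for i j k l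
    proof -
      have "alt_mean (T i j k l) us = alt_mean (\<lambda>_. 0) us"
      proof (rule alt_mean_cong)
        fix ys :: "U list" assume "length ys = length us"
        then have "ys = [] \<or> butlast ys = []" using False
          by (cases ys rule: rev_cases) (auto simp: n_def simp flip: length_0_conv)
        then show "T i j k l ys = 0" by (auto simp: T_def app_last_def)
      qed
      then show ?thesis by (simp add: alt_mean_def alt_sum_def)
    qed
    then show ?thesis by (simp add: wedge_wedge T_def)
  qed
qed

lemma U_eq_neg_self: "x = - x \<Longrightarrow> x = (0 :: U)"
proof -
  assume "x = - x"
  then have "x + x = 0" by (subst (asm) eq_neg_iff_add_eq_0)
  then have "2 * x = 0" by (simp only: mult_2)
  then show ?thesis by (simp only: mult_eq_0_iff) simp
qed

text \<open>
  Skew forms with values in \<open>U\<close> obey the jet calculus: differentiation acts on values, and therefore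
  satisfies the Leibniz rule with respect to the jets of the arguments.
\<close>

interpretation jets: odd_jets wedge fun_d1 fun_d2
proof (unfold_locales; rule ext)
  fix i j k l :: nat and g h :: "U list \<Rightarrow> U" and us :: "U list"
  show "wedge i j (g + h) us = (wedge i j g + wedge i j h) us"
    unfolding wedge_def plus_fun_apply alt_mean_add[symmetric]
    by (rule alt_mean_cong) (simp add: app_last_def ring_distribs)
  show "fun_d1 (wedge i j g) us = (wedge (Suc i) j g + wedge i j (fun_d1 g)) us"
    unfolding wedge_def plus_fun_apply alt_mean_add[symmetric] fun_d1_def
    unfolding alt_mean_additive[of d1, OF d1_add d1_const, symmetric]
    by (rule alt_mean_cong) (simp add: app_last_def fun_d1_def d1_mult d1_jet)
  show "fun_d2 (wedge i j g) us = (wedge i (Suc j) g + wedge i j (fun_d2 g)) us"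
    unfolding wedge_def plus_fun_apply alt_mean_add[symmetric] fun_d2_def
    unfolding alt_mean_additive[of d2, OF d2_add d2_const, symmetric]
    by (rule alt_mean_cong) (simp add: app_last_def fun_d2_def d2_mult d2_jet)
  show "wedge i j (wedge k l g) us = (- wedge k l (wedge i j g)) us"
    by (simp only: fun_Compl_def) (rule wedge_anticomm)
  show "wedge i j (wedge i j g) us = 0 us"
    by (simp only: zero_fun_apply) (rule U_eq_neg_self[OF wedge_anticomm])
qed (simp_all add: fun_d1_def fun_d2_def d1_add d2_add d1_d2)

lemma deriv_apply: "jets.deriv (i, j) F us = jet i j (F us)"
proof -
  have 2: "(fun_d2 ^^ j) F us = (d2 ^^ j) (F us)" for us
    by (induction j arbitrary: us) (simp_all add: fun_d2_def)
  have 1: "(fun_d1 ^^ i) F us = (d1 ^^ i) (F us)" for F us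
    by (induction i arbitrary: us) (simp_all add: fun_d1_def)
  show ?thesis by (simp add: jets.deriv_def jet_def 1 2)
qed

definition tensor :: "(nat \<times> nat) list \<Rightarrow> U list \<Rightarrow> U" where
  "tensor w us = (\<Prod>(p, u) \<leftarrow> zip w us. jet (fst p) (snd p) u)"

lemma tensor_snoc:
  "length w = length us \<Longrightarrow> tensor (w @ [p]) (us @ [u]) = tensor w us * jet (fst p) (snd p) u"
  by (simp add: tensor_def)

lemma tensor_permute:
  assumes "length w = length us" "\<sigma> permutes {..<length us}"
  shows "tensor (permute_list \<sigma> w) (permute_list \<sigma> us) = tensor w us"
proof -
  have "zip (permute_list \<sigma> w) (permute_list \<sigma> us) = permute_list \<sigma> (zip w us)"
    using assms by (simp add: permute_list_zip[of _ "{..<length us}"])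
  moreover have "mset (permute_list \<sigma> (zip w us)) = mset (zip w us)"
    using assms by (intro mset_permute_list) simp
  moreover have "prod_list (map h xs) = prod_mset (image_mset h (mset xs))"
    for h :: "(nat \<times> nat) \<times> U \<Rightarrow> U" and xs
    by (simp only: prod_mset_prod_list flip: mset_map)
  ultimately show ?thesis
    unfolding tensor_def by (simp only:)
qed

text \<open>
  A word of odd jets alternates a product in which each jet takes an argument of its own, the first
  letter being applied first and hence sitting directly after the arguments of \<open>F\<close>.
\<close>

lemma M_word_eq_alt_mean:
  assumes "w \<noteq> []" "length w \<le> length us"
  shows "jets.M_word w F us =
    alt_mean (\<lambda>vs. F (take (length us - length w) vs) * tensor w (drop (length us - length w) vs)) us"
  using assms
proof (induction w arbitrary: us rule: rev_induct)
  case (snoc p w)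
  define n where "n = length us - Suc (length w)"
  have "jets.M_word (w @ [p]) F us = alt_mean (app_last (\<lambda>g u. g * jet (fst p) (snd p) u) (jets.M_word w F)) us"
    by (simp add: jets.M_word_def wedge_def split_beta)
  also have "\<dots> = alt_mean (app_last (\<lambda>g u. g * jet (fst p) (snd p) u)
     (\<lambda>vs. F (take n vs) * tensor w (drop n vs))) us"
  proof (cases "w = []")
    case True
    show ?thesis using snoc.prems unfolding True
      by (intro alt_mean_cong) (auto simp: jets.M_word_def app_last_def tensor_def n_def True)
  next
    case False
    have "alt_mean (app_last (\<lambda>g u. g * jet (fst p) (snd p) u) (jets.M_word w F)) us =
      alt_mean (app_last (\<lambda>g u. g * jet (fst p) (snd p) u)
     (alt_mean (\<lambda>vs. F (take n vs) * tensor w (drop n vs)))) us"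
    proof (rule alt_mean_cong)
      fix ys :: "U list" assume "length ys = length us"
      then show "app_last (\<lambda>g u. g * jet (fst p) (snd p) u) (jets.M_word w F) ys =
        app_last (\<lambda>g u. g * jet (fst p) (snd p) u)  (alt_mean (\<lambda>vs. F (take n vs) * tensor w (drop n vs))) ys"
        using False snoc.prems by (simp add: app_last_def snoc.IH n_def)
    qed
    then show ?thesis by (simp add: alt_mean_mult_alt_mean)
  qed
  also have "\<dots> = alt_mean (\<lambda>vs. F (take n vs) * tensor (w @ [p]) (drop n vs)) us"
  proof (rule alt_mean_cong)
    fix ys :: "U list" assume "length ys = length us"
    then show "app_last (\<lambda>g u. g * jet (fst p) (snd p) u) (\<lambda>vs. F (take n vs) * tensor w (drop n vs)) ys
      = F (take n ys) * tensor (w @ [p]) (drop n ys)"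
      using snoc.prems by (cases ys rule: rev_cases) (auto simp: app_last_def n_def tensor_snoc mult_ac)
  qed
  finally show ?case by (simp add: n_def)
qed simp

section \<open>Hamiltonian vector fields\<close>

definition ham :: "U \<Rightarrow> oper" where
  "ham u = vf (- d2 u) (d1 u)"

lemma ham_apply: "ham u f = d1 u * d2 f - d2 u * d1 f"
  by (simp add: ham_def vf_def)

lemma ham_add: "ham u (f + g) = ham u f + ham u g"
  and ham_const: "ham u (const c * f) = const c * ham u f"
  by (simp_all add: ham_apply d1_add d2_add d1_const d2_const ring_distribs mult.left_commute)

lemma ham_scale: "ham (const c * u) f = const c * ham u f"
  by (simp add: ham_apply d1_const d2_const ring_distribs mult.left_commute)

lemma ham_add_left: "ham (u + v) = ham u + ham v"
  by (rule ext) (simp add: ham_apply d1_add d2_add algebra_simps)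

lemma cscale_ham: "cscale c (ham u) = ham (const c * u)"
  by (rule ext) (simp add: cscale_apply ham_scale)

lemma foldl_ham_add: "foldl (\<lambda>g u. ham u g) (f + g) us = foldl (\<lambda>g u. ham u g) f us + foldl (\<lambda>g u. ham u g) g us"
  by (induction us arbitrary: f g) (simp_all add: ham_add)

lemma foldl_ham_const: "foldl (\<lambda>g u. ham u g) (const c * f) us = const c * foldl (\<lambda>g u. ham u g) f us"
  by (induction us arbitrary: f) (simp_all add: ham_const)

text \<open>
  The function \<open>s n\<close> divides by \<open>n + 1\<close>. It is a parameter because the lemma is needed both for
  coefficients in \<open>\<complex>\<close> and for coefficients in \<open>\<complex>[x\<^sub>1]\<close>.
\<close>

lemma poly_antiderivative:
  fixes s :: "nat \<Rightarrow> 'a::{comm_semiring_1,semiring_no_zero_divisors} \<Rightarrow> 'a"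
  assumes "\<And>n a. of_nat (Suc n) * s n a = a"
  shows "\<exists>q. pderiv q = (p :: 'a poly)"
proof
  have "pderiv (\<Sum>i\<le>degree p. monom (s i (coeff p i)) (Suc i)) = (\<Sum>i\<le>degree p. monom (coeff p i) i)"
    by (simp add: pderiv_sum pderiv_monom assms del: of_nat_Suc)
  then show "pderiv (\<Sum>i\<le>degree p. monom (s i (coeff p i)) (Suc i)) = p"
    by (simp add: poly_as_sum_of_monoms)
qed

text \<open>
  The Poincare lemma for polynomials: the first coefficient is integrated along \<open>x\<^sub>2\<close>, and what is then
  missing in the second one along \<open>x\<^sub>1\<close>.
\<close>

lemma Vect2_0_eq: "Vect2_0 = range ham"
proof (intro equalityI subsetI)
  fix X assume "X \<in> range ham"
  then show "X \<in> Vect2_0"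
    by (auto simp: Vect2_0_def Vect2_def ham_def Div_vf d1_minus d1_d2)
next
  fix X assume "X \<in> Vect2_0"
  then obtain p q where X: "X = vf p q" and div: "d1 p + d2 q = 0"
    by (auto simp: Vect2_0_def Vect2_def Div_vf)
  have "of_nat (Suc n) * smult (1 / of_nat (Suc n)) a = a" for n and a :: "complex poly"
    by (simp add: of_nat_poly del: of_nat_Suc)
  from poly_antiderivative[of "\<lambda>n. smult (1 / of_nat (Suc n))", OF this]
  obtain r where r: "d2 r = - p" by (auto simp: d2_def)
  \<comment> \<open>the defect of \<open>r\<close> in the second coefficient depends on \<open>x\<^sub>1\<close> only\<close>
  have "d2 (q - d1 r) = 0"
    using div r by (simp add: d2_diff d1_d2 d1_minus add.commute)
  then obtain c where c: "q - d1 r = [:c:]"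
    by (auto simp: d2_def pderiv_eq_0_iff elim: degree_eq_zeroE)
  have "of_nat (Suc n) * (a / of_nat (Suc n)) = a" for n and a :: complex
    by (simp del: of_nat_Suc)
  from poly_antiderivative[of "\<lambda>n a. a / of_nat (Suc n)", OF this]
  obtain e where e: "pderiv e = c" by blast
  have "d1 [:e:] = [:c:]" "d2 [:e:] = 0"
    using e by (simp_all add: d1_def d2_def map_poly_pCons pderiv_pCons)
  then have "X = ham (r + [:e:])"
    using X r c by (simp add: ham_def d1_add d2_add algebra_simps)
  then show "X \<in> range ham" by simp
qed

lemma Vect2_0_list:
  assumes "set Xs \<subseteq> Vect2_0"
  obtains us where "Xs = map ham us"
  using assms unfolding Vect2_0_eq by (metis ex_map_conv subset_iff image_iff rangeE)

lemma Vect2_0_add: "X \<in> Vect2_0 \<Longrightarrow> X (f + g) = X f + X g"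
  by (auto simp: Vect2_0_eq ham_add)

lemma Vect2_0_diff: "X \<in> Vect2_0 \<Longrightarrow> X (f - g) = X f - X g"
  using Vect2_0_add[of X "f - g" g] by (simp add: algebra_simps)

text \<open>
  Iterated commutators of Hamiltonian fields can therefore be computed on their Hamiltonians, by the
  action on functions.
\<close>

lemma ham_ham: "comm (ham v) (ham u) = ham (ham u v)"
  by (rule ext) (simp add: comm_def rcomp_def ham_apply d1_mult d2_mult d1_diff d2_diff d1_d2 algebra_simps)

section \<open>The five-commutator as a determinant of jets\<close>

lemma left_normed_rcomp: "Xs \<noteq> [] \<Longrightarrow> left_normed rcomp Xs f = foldl (\<lambda>g X. X g) f Xs"
proof -
  have "foldl rcomp X Xs f = foldl (\<lambda>g X. X g) (X f) Xs" for X and Xs :: "('a \<Rightarrow> 'a) list"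
    by (induction Xs arbitrary: X) (auto simp: rcomp_def)
  then show "Xs \<noteq> [] \<Longrightarrow> ?thesis"
    by (cases Xs) (auto simp: left_normed_def)
qed

lemma s_std_apply:
  assumes "Xs \<noteq> []"
  shows "s_std Xs f = alt_sum (\<lambda>Ys. foldl (\<lambda>g X. X g) f Ys) Xs"
  unfolding skew_poly_eq_alt_sum alt_sum_apply
proof (rule alt_sum_cong)
  fix Ys :: "('a \<Rightarrow> 'a) list"
  assume "length Ys = length Xs"
  then show "left_normed rcomp Ys f = foldl (\<lambda>g X. X g) f Ys"
    using assms by (intro left_normed_rcomp) auto
qed

lemma ham_odd_eq: "jets.ham_odd F us = alt_mean (app_last (\<lambda>g u. ham u g) F) us"
proof -
  have "jets.ham_odd F us = alt_mean (\<lambda>ys. app_last (\<lambda>g u. g * jet 1 0 u) (fun_d2 F) ys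
        + - app_last (\<lambda>g u. g * jet 0 1 u) (fun_d1 F) ys) us"
    unfolding alt_mean_add by (simp add: jets.ham_odd_def wedge_def alt_mean_def alt_sum_minus)
  also have "\<dots> = alt_mean (app_last (\<lambda>g u. ham u g) F) us"
    by (rule alt_mean_cong) (simp add: app_last_def ham_apply fun_d1_def fun_d2_def jet_def mult.commute)
  finally show ?thesis .
qed

text \<open>
  The link between the jet calculus and the standard polynomials: powers of the odd operator,
  started at a constant function, alternate the iterated action of Hamiltonian fields.
\<close>

lemma ham_odd_pow:
  assumes "length us = n"
  shows "(jets.ham_odd ^^ n) (\<lambda>_. f) us = alt_mean (\<lambda>us. foldl (\<lambda>g u. ham u g) f us) us"
  using assms
proof (induction n arbitrary: us)
  case 0
  have "{\<sigma>. \<sigma> permutes {..<0::nat}} = {id}" by (auto simp: permutes_def)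
  then show ?case using 0 by (simp add: alt_mean_def alt_sum_def)
next
  case (Suc n)
  have "(jets.ham_odd ^^ Suc n) (\<lambda>_. f) us = alt_mean (app_last (\<lambda>g u. ham u g) ((jets.ham_odd ^^ n) (\<lambda>_. f))) us"
    by (simp add: ham_odd_eq)
  also have "\<dots> = alt_mean (app_last (\<lambda>g u. ham u g) (alt_mean (\<lambda>us. foldl (\<lambda>g u. ham u g) f us))) us"
    using Suc by (intro alt_mean_cong) (auto simp: app_last_def)
  also have "\<dots> = alt_mean (app_last (\<lambda>g u. ham u g) (\<lambda>us. foldl (\<lambda>g u. ham u g) f us)) us"
    by (rule alt_mean_app_last) (simp_all add: ham_add ham_const)
  also have "\<dots> = alt_mean (\<lambda>us. foldl (\<lambda>g u. ham u g) f us) us"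
  proof (rule alt_mean_cong)
    fix ys :: "U list" assume "length ys = length us"
    then show "app_last (\<lambda>g u. ham u g) (\<lambda>us. foldl (\<lambda>g u. ham u g) f us) ys = foldl (\<lambda>g u. ham u g) f ys"
      using Suc.prems by (cases ys rule: rev_cases) (auto simp: app_last_def)
  qed
  finally show ?case .
qed

lemma s_std_ham:
  assumes "us \<noteq> []"
  shows "s_std (map ham us) f = const (fact (length us)) * (jets.ham_odd ^^ length us) (\<lambda>_. f) us"
proof -
  have "s_std (map ham us) f = alt_sum (\<lambda>us. foldl (\<lambda>g u. ham u g) f us) us"
    using assms by (simp add: s_std_apply alt_sum_map foldl_map)
  then show ?thesis by (simp add: ham_odd_pow fact_alt_mean)
qed

lemma s6_ham: "length us = 6 \<Longrightarrow> s_std (map ham us) = 0"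
  using s_std_ham[of us] by (fastforce simp: fun_eq_iff eval_nat_numeral jets.ham_odd_6)

lemma s6_eq_0:
  assumes "length Xs = 6" "set Xs \<subseteq> Vect2_0"
  shows "s_std Xs = 0"
  using assms by (elim Vect2_0_list) (auto simp: s6_ham)

definition jets5 :: "(nat \<times> nat) list" where
  "jets5 = [(2, 0), (1, 1), (1, 0), (0, 2), (0, 1)]"

lemma length_jets5: "length jets5 = 5"
  by (simp add: jets5_def)

text \<open>
  Alternating the product of the five jets of order one and two over five arguments is taking the
  determinant of the \<open>5 \<times> 5\<close> matrix of these jets. The factor 3 is the one in \<open>ham_odd_5\<close>.
\<close>

definition jet_det :: "U list \<Rightarrow> U" where
  "jet_det us = const 3 * alt_sum (tensor jets5) us"

lemma jet_word_const:
  assumes "length us = 5"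
  shows "jets.jet_word (\<lambda>_. f) us = f * alt_mean (tensor jets5) us"
proof -
  have "jets.jet_word (\<lambda>_. f) us = jets.M_word jets5 (\<lambda>_. f) us"
    by (simp add: jets.jet_word_def jets.M_word_def jets5_def)
  also have "\<dots> = alt_mean (\<lambda>vs. f * tensor jets5 vs) us"
    using assms by (subst M_word_eq_alt_mean) (simp_all add: jets5_def)
  also have "\<dots> = f * alt_mean (tensor jets5) us"
    by (rule alt_mean_additive) (simp_all add: ring_distribs mult.left_commute)
  finally show ?thesis .
qed

text \<open>
  At a constant function with value \<open>f\<close> the five jets and the derivatives of \<open>f\<close> separate, and the closed
  form of the fifth power becomes \<open>3 (\<partial>\<^sub>x(k f\<^sub>y) - \<partial>\<^sub>y(k f\<^sub>x)) = 3 {k, f}\<close>: the second derivatives of \<open>f\<close> cancel.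
\<close>

lemma s5_ham:
  assumes us: "length us = 5"
  shows "s_std (map ham us) = ham (jet_det us)"
proof
  fix f
  define k where "k = alt_mean (tensor jets5) us"
  have dconst: "fun_d1 (\<lambda>_. f) = (\<lambda>_. d1 f)" "fun_d2 (\<lambda>_. f) = (\<lambda>_. d2 f)"
    by (simp_all add: fun_eq_iff fun_d1_def fun_d2_def)
  have K: "fun_d1 (jets.jet_word (\<lambda>_. g)) us = d1 (g * k)" "fun_d2 (jets.jet_word (\<lambda>_. g)) us = d2 (g * k)" for g
    using us by (simp_all add: fun_d1_def fun_d2_def jet_word_const k_def)
  have "(jets.ham_odd ^^ 5) (\<lambda>_. f) us =
      d1 (d2 f * k) + d1 (d2 f * k) + d1 (d2 f * k) - d2 (d1 f * k) - d2 (d1 f * k) - d2 (d1 f * k)"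
    by (simp add: eval_nat_numeral jets.ham_odd_5 dconst K)
  also have "\<dots> = 3 * ham k f"
    by (simp add: d1_mult d2_mult d1_d2 ham_apply algebra_simps)
  finally have "s_std (map ham us) f = const (fact 5) * (3 * ham k f)"
    using us s_std_ham[of us f] by fastforce
  also have "3 = const 3"
    using const_of_nat[of 3] by simp
  also have "const (fact 5) * (const 3 * ham k f) = const 3 * (const (fact 5) * ham k f)"
    by (simp add: mult.commute)
  also have "\<dots> = ham (const 3 * (const (fact 5) * k)) f"
    by (simp only: ham_scale)
  also have "const (fact 5) * k = alt_sum (tensor jets5) us"
    using fact_alt_mean[of us "tensor jets5"] us by (simp add: k_def)
  finally show "s_std (map ham us) f = ham (jet_det us) f"
    by (simp only: jet_det_def)
qed

lemma s5_closed:
  assumes "length Xs = 5" "set Xs \<subseteq> Vect2_0"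
  shows "s_std Xs \<in> Vect2_0"
  using assms by (elim Vect2_0_list) (auto simp: s5_ham Vect2_0_eq)

lemma d_coords: "d1 x1 = 1" "d2 x1 = 0" "d1 x2 = 0" "d2 x2 = 1" "d1 1 = 0" "d2 1 = 0"
  by (simp_all add: d1_def d2_def x1_def x2_def map_poly_pCons pderiv_pCons one_pCons)

lemma d_numeral: "d1 (numeral n) = 0" "d2 (numeral n) = 0"
proof -
  have "d1 (of_nat k) = 0 \<and> d2 (of_nat k) = 0" for k
    by (induction k) (simp_all add: d1_add d2_add d_coords)
  from this[of "numeral n"] show "d1 (numeral n) = 0" "d2 (numeral n) = 0" by simp_all
qed

text \<open>
  The Hamiltonians \<open>x\<^sub>1\<^sup>2, x\<^sub>1x\<^sub>2, x\<^sub>1, x\<^sub>2\<^sup>3, x\<^sub>2\<close> make the jet matrix triangular. The cube is there because with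
  \<open>x\<^sub>2\<^sup>2\<close> in its place the determinant would be a nonzero constant, whose Hamiltonian field is 0.
\<close>

lemma s5_nonzero: "\<exists>Xs. length Xs = 5 \<and> set Xs \<subseteq> Vect2_0 \<and> s_std Xs \<noteq> 0"
proof -
  define us where "us = [x1 * x1, x1 * x2, x1, x2 * x2 * x2, x2]"
  have len: "length us = 5" by (simp add: us_def)
  \<comment> \<open>row \<open>i\<close> of the jet matrix vanishes to the right of the diagonal, so only the identity contributes\<close>
  have upper: "jet (fst (jets5 ! i)) (snd (jets5 ! i)) (us ! j) = 0" if "i < j" "j < 5" for i j
  proof -
    have "j = 1 \<or> j = 2 \<or> j = 3 \<or> j = 4" "i = 0 \<or> i = 1 \<or> i = 2 \<or> i = 3"
      using that by auto
    then show ?thesis using that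
      by (elim disjE) (simp_all add: jets5_def us_def jet_def d_coords d_numeral d1_mult d2_mult d1_add d2_add numeral_2_eq_2)
  qed
  have tensor_nth: "tensor jets5 vs = (\<Prod>i<5. jet (fst (jets5 ! i)) (snd (jets5 ! i)) (vs ! i))"
    if "length vs = 5" for vs
  proof -
    have "tensor jets5 vs = prod_list (map (\<lambda>i. jet (fst (jets5 ! i)) (snd (jets5 ! i)) (vs ! i)) [0..<5])"
      unfolding tensor_def using that
      by (intro arg_cong[of _ _ prod_list] nth_equalityI) (auto simp: jets5_def)
    then show ?thesis by (simp add: prod.list_conv_set_nth atLeast0LessThan)
  qed
  have "alt_sum (tensor jets5) us = (\<Sum>\<sigma> | \<sigma> permutes {..<5::nat}. if \<sigma> = id then tensor jets5 us else 0)"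
    unfolding alt_sum_def len
  proof (intro sum.cong refl)
    fix \<sigma> :: "nat \<Rightarrow> nat" assume "\<sigma> \<in> {\<sigma>. \<sigma> permutes {..<5}}"
    then have \<sigma>: "\<sigma> permutes {..<5}" by simp
    show "signed \<sigma> (tensor jets5 (permute_list \<sigma> us)) = (if \<sigma> = id then tensor jets5 us else 0)"
    proof (cases "\<sigma> = id")
      case False
      then obtain i where i: "i < 5" "i < \<sigma> i"
        using permutes_natset_le[OF \<sigma>] by (metis lessThan_iff not_le)
      then have "jet (fst (jets5 ! i)) (snd (jets5 ! i)) (permute_list \<sigma> us ! i) = 0"
        using upper[of i "\<sigma> i"] \<sigma> permutes_in_image[OF \<sigma>, of i] by (simp add: permute_list_nth len)
      then have "tensor jets5 (permute_list \<sigma> us) = 0"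
        using i by (subst tensor_nth) (auto simp: len)
      then show ?thesis using False by simp
    qed simp
  qed
  also have "\<dots> = tensor jets5 us"
    by (simp add: finite_permutations permutes_id)
  also have "\<dots> = 12 * x2"
    by (simp add: tensor_def jets5_def us_def jet_def d_coords d_numeral d1_mult d2_mult d1_add d2_add numeral_2_eq_2)
  finally have h: "jet_det us = const 3 * (12 * x2)" by (simp add: jet_det_def)
  have "s_std (map ham us) x1 = const 3 * (12 * ham x2 x1)"
    unfolding s5_ham[OF len] h ham_scale by (simp add: ham_apply d_coords d_numeral d1_mult d2_mult)
  also have "ham x2 x1 = - 1" by (simp add: ham_apply d_coords)
  finally have "s_std (map ham us) x1 \<noteq> 0" by (simp add: const_def)
  then have "s_std (map ham us) \<noteq> 0" by auto
  then show ?thesis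
    by (intro exI[of _ "map ham us"]) (auto simp: len Vect2_0_eq)
qed

lemma vf_add: "vf (p + p') (q + q') = vf p q + vf p' q'"
  by (rule ext) (simp add: vf_def algebra_simps)

text \<open>
  A right-symmetric product lets its right factor act on the coefficients of its left factor, so
  left-normed products just apply all factors in turn to the coordinates.
\<close>

lemma left_normed_rsym:
  assumes "Xs \<noteq> []" "set Xs \<subseteq> Vect2"
  shows "left_normed rsym Xs = vf (foldl (\<lambda>g X. X g) x1 Xs) (foldl (\<lambda>g X. X g) x2 Xs)"
proof -
  have "foldl rsym (vf p q) Ys = vf (foldl (\<lambda>g X. X g) p Ys) (foldl (\<lambda>g X. X g) q Ys)" for Ys p q
    by (induction Ys arbitrary: p q) (auto simp: rsym_def vf_x1 vf_x2)
  moreover obtain p q where "hd Xs = vf p q" using assms by (cases Xs) (auto simp: Vect2_def)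
  ultimately show ?thesis
    using assms by (cases Xs) (auto simp: left_normed_def vf_x1 vf_x2)
qed

text \<open>
  The right-symmetric polynomial has the values of \<open>s\<^sub>k\<close> at the coordinates as coefficients;
  it can differ from \<open>s\<^sub>k\<close> only if \<open>s\<^sub>k\<close> is not a vector field.
\<close>

lemma s_rsym_r_eq:
  assumes "Xs \<noteq> []" "set Xs \<subseteq> Vect2"
  shows "s_rsym_r Xs = vf (s_std Xs x1) (s_std Xs x2)"
proof -
  let ?F = "\<lambda>Ys x. foldl (\<lambda>g X. X g) x Ys :: U"
  have "s_rsym_r Xs = alt_sum (\<lambda>Ys. vf (?F Ys x1) (?F Ys x2)) Xs"
    unfolding skew_poly_eq_alt_sum
    using assms by (intro alt_sum_cong left_normed_rsym) (auto dest: mset_eq_setD)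
  also have "\<dots> = alt_sum (\<lambda>Ys. vf (?F Ys x1) 0 + vf 0 (?F Ys x2)) Xs"
    by (simp flip: vf_add)
  also have "\<dots> = vf (alt_sum (\<lambda>Ys. ?F Ys x1) Xs) 0 + vf 0 (alt_sum (\<lambda>Ys. ?F Ys x2) Xs)"
    unfolding alt_sum_add
    by (intro arg_cong2[of _ _ _ _ "(+)"] alt_sum_additive) (simp_all add: fun_eq_iff vf_def ring_distribs)
  finally show ?thesis
    using assms by (simp add: s_std_apply flip: vf_add)
qed

lemma s5_eq_rsym:
  assumes "length Xs = 5" "set Xs \<subseteq> Vect2_0"
  shows "s_std Xs = s_rsym_r Xs"
proof -
  obtain p q where pq: "s_std Xs = vf p q"
    using s5_closed[OF assms] by (auto simp: Vect2_0_def Vect2_def)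
  have "Xs \<noteq> []" "set Xs \<subseteq> Vect2" using assms by (auto simp: Vect2_0_def)
  then show ?thesis using s_rsym_r_eq[of Xs] by (simp add: pq vf_x1 vf_x2)
qed

text \<open>
  Both sides iterate the same action, once on Hamiltonian fields and once on their Hamiltonians.
\<close>

lemma s_std_ad_ham:
  assumes "us \<noteq> []"
  shows "s_std (map ad (map ham us)) (ham v) = ham (s_std (map ham us) v)"
proof -
  have *: "foldl (\<lambda>Y u. ad (ham u) Y) (ham v) us = ham (foldl (\<lambda>g u. ham u g) v us)" for us v
    by (induction us arbitrary: v) (simp_all add: ad_def ham_ham)
  have "s_std (map ad (map ham us)) (ham v) = alt_sum (\<lambda>us. ham (foldl (\<lambda>g u. ham u g) v us)) us"
    using assms by (simp add: s_std_apply alt_sum_map foldl_map *)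
  also have "\<dots> = ham (s_std (map ham us) v)"
    using assms by (simp add: alt_sum_additive ham_add_left s_std_apply alt_sum_map foldl_map)
  finally show ?thesis .
qed

lemma ad_s5:
  assumes "length Xs = 5" "set Xs \<subseteq> Vect2_0" "Y \<in> Vect2_0"
  shows "ad (s_std Xs) Y = s_std (map ad Xs) Y"
proof -
  obtain us where us: "Xs = map ham us" using assms Vect2_0_list by blast
  obtain v where v: "Y = ham v" using assms by (auto simp: Vect2_0_eq)
  have len: "length us = 5" "us \<noteq> []" using assms us by auto
  show ?thesis
    using len(1) unfolding us v s_std_ad_ham[OF len(2)]
    by (simp add: s5_ham ad_def ham_ham)
qed

section \<open>Multilinearity and the Lie bracket\<close>

text \<open>
  In terms of Hamiltonians every iterated action is linear in each of them, and alternation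
  preserves this.
\<close>

lemma skew_operation_s_std:
  assumes "m > 0" and closed: "\<And>Xs. length Xs = m \<Longrightarrow> set Xs \<subseteq> Vect2_0 \<Longrightarrow> s_std Xs \<in> Vect2_0"
  shows "skew_operation cscale Vect2_0 m s_std"
proof -
  interpret vector_space cscale by (rule vector_space_cscale)
  have s: "s_std (map ham us) f = alt_sum (\<lambda>us. foldl (\<lambda>g u. ham u g) f us) us"
    if "us \<noteq> []" for us f
    using that by (simp add: s_std_apply alt_sum_map foldl_map)
  have sub: "subspace Vect2_0"
    unfolding subspace_def Vect2_0_eq
  proof (intro conjI ballI allI)
    have "ham 0 = 0" by (rule ext) (simp add: ham_apply)
    then show "0 \<in> range ham" by (metis rangeI)
  qed (auto simp: cscale_ham simp flip: ham_add_left)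
  have add: "s_std (as @ (a + b) # bs) = s_std (as @ a # bs) + s_std (as @ b # bs)"
    if "set as \<union> {a, b} \<union> set bs \<subseteq> Vect2_0" for as bs a b
  proof -
    have ab: "a \<in> Vect2_0" "b \<in> Vect2_0" using that by auto
    have "set as \<subseteq> Vect2_0" "set bs \<subseteq> Vect2_0" using that by auto
    then obtain us ws where "as = map ham us" "bs = map ham ws" by (metis Vect2_0_list)
    moreover obtain u v where "a = ham u" "b = ham v" using ab by (auto simp: Vect2_0_eq)
    ultimately have e: "as @ (a + b) # bs = map ham (us @ (u + v) # ws)"
      "as @ a # bs = map ham (us @ u # ws)" "as @ b # bs = map ham (us @ v # ws)"
      by (simp_all add: ham_add_left)
    show ?thesis
    proof
      fix f
      have "alt_sum (\<lambda>us. foldl (\<lambda>g u. ham u g) f us) (us @ (u + v) # ws) =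
        alt_sum (\<lambda>us. foldl (\<lambda>g u. ham u g) f us) (us @ u # ws) +
        alt_sum (\<lambda>us. foldl (\<lambda>g u. ham u g) f us) (us @ v # ws)"
        by (rule alt_sum_slot_add) (simp add: ham_add_left foldl_ham_add)
      then show "s_std (as @ (a + b) # bs) f = (s_std (as @ a # bs) + s_std (as @ b # bs)) f"
        unfolding e plus_fun_apply by (subst (1 2 3) s) simp_all
    qed
  qed
  have scale: "s_std (as @ cscale c a # bs) = cscale c (s_std (as @ a # bs))"
    if "set as \<union> {a} \<union> set bs \<subseteq> Vect2_0" for as bs a c
  proof -
    have a: "a \<in> Vect2_0" using that by auto
    have "set as \<subseteq> Vect2_0" "set bs \<subseteq> Vect2_0" using that by auto
    then obtain us ws where "as = map ham us" "bs = map ham ws" by (metis Vect2_0_list)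
    moreover obtain u where "a = ham u" using a by (auto simp: Vect2_0_eq)
    ultimately have e: "as @ cscale c a # bs = map ham (us @ (const c * u) # ws)"
      "as @ a # bs = map ham (us @ u # ws)"
      by (simp_all add: cscale_ham)
    show ?thesis
    proof
      fix f
      have "alt_sum (\<lambda>us. foldl (\<lambda>g u. ham u g) f us) (us @ (const c * u) # ws) =
        const c * alt_sum (\<lambda>us. foldl (\<lambda>g u. ham u g) f us) (us @ u # ws)"
        by (rule alt_sum_slot_scale) (simp_all add: ham_scale foldl_ham_const ring_distribs)
      then show "s_std (as @ cscale c a # bs) f = cscale c (s_std (as @ a # bs)) f"
        unfolding e cscale_apply by (subst (1 2) s) simp_all
    qed
  qed
  have "s_std (permute_list \<sigma> as) = signed \<sigma> (s_std as)"
    if "length as = m" "\<sigma> permutes {..<m}" for as :: "oper list" and \<sigma>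
    using that by (simp add: skew_poly_eq_alt_sum alt_sum_permute)
  then show ?thesis
    unfolding skew_operation_def
    using vector_space_cscale sub closed by (auto simp: add scale)
qed

lemma permutes_2: "{\<sigma>. \<sigma> permutes {..<2}} = {id, transpose 0 (1::nat)}"
proof -
  have "{..<2} = {0, 1::nat}" by auto
  then show ?thesis by (auto simp: permutes_doubleton_iff)
qed

lemma s_std_2: "s_std [X, Y] = comm X Y" for X Y :: oper
proof -
  have "id \<noteq> transpose 0 (1::nat)"
    by (metis id_apply transpose_apply_first zero_neq_one)
  moreover have "permute_list (transpose 0 1) [X, Y] = [Y, X]"
    by (simp add: permute_list_def)
  ultimately show ?thesis
    unfolding skew_poly_eq_alt_sum alt_sum_def
    by (simp add: numeral_2_eq_2[symmetric] permutes_2 signed_def sign_swap_id left_normed_def comm_def)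
qed

lemma comm_Jacobi:
  assumes "a \<in> Vect2_0" "b \<in> Vect2_0" "c \<in> Vect2_0"
  shows "comm (comm a b) c + comm (comm b c) a + comm (comm c a) b = 0"
proof -
  obtain u v w where "a = ham u" "b = ham v" "c = ham w"
    using assms by (auto simp: Vect2_0_eq)
  moreover have "ham w (ham v u) + ham u (ham w v) + ham v (ham u w) = 0"
    by (simp add: ham_apply d1_mult d2_mult d1_diff d2_diff d1_d2 algebra_simps)
  moreover have "ham 0 = 0" by (rule ext) (simp add: ham_apply)
  ultimately show ?thesis by (simp add: ham_ham flip: ham_add_left)
qed

lemma lie_algebra_s2: "lie_algebra cscale Vect2_0 s_std"
  unfolding lie_algebra_def s_std_2
proof (intro conjI ballI comm_Jacobi)
  show "skew_operation cscale Vect2_0 2 s_std"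
  proof (rule skew_operation_s_std)
    fix Xs :: "oper list" assume "length Xs = 2" "set Xs \<subseteq> Vect2_0"
    then obtain u v where "Xs = [ham u, ham v]"
      by (elim Vect2_0_list) (auto simp: length_Suc_conv numeral_2_eq_2)
    then show "s_std Xs \<in> Vect2_0" by (simp add: s_std_2 ham_ham Vect2_0_eq)
  qed simp
qed

section \<open>Left commutativity\<close>

text \<open>
  The pigeonhole principle, in terms of alternating sums: four jets of the outer determinant stand
  beside four jets of the inner one, the latter differentiated once or twice.
\<close>

lemma alt_sum_tensor_jet_tensor_eq_0:
  assumes w: "distinct w" "length w = 4" "set w \<subseteq> set jets5"
    and w': "distinct w'" "length w' = 4" "set w' \<subseteq> set jets5"
    and p: "(i, j) \<in> set jets5" and us: "length us = 8"
  shows "alt_sum (\<lambda>us. tensor w (take 4 us) * jet i j (tensor w' (drop 4 us) * c)) us = 0"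
proof -
  \<comment> \<open>exchanges the two blocks of four arguments: words of odd jets have the inner jets in front\<close>
  define \<rho> where "\<rho> = (\<lambda>i::nat. if i < 4 then i + 4 else if i < 8 then i - 4 else i)"
  have "\<rho> \<circ> \<rho> = id" by (auto simp: \<rho>_def fun_eq_iff)
  then have "bij \<rho>" by (metis o_bij)
  moreover have "\<forall>x. x \<notin> {..<length us} \<longrightarrow> \<rho> x = x"
    by (auto simp: \<rho>_def us)
  ultimately have \<rho>: "\<rho> permutes {..<length us}"
    unfolding permutes_def bij_iff by blast
  have swap: "permute_list \<rho> xs = drop 4 xs @ take 4 xs" if "length xs = 8" for xs :: "U list"
    using that by (intro nth_equalityI) (auto simp: permute_list_def \<rho>_def nth_append add.commute)
  have "signed \<rho> (alt_sum (\<lambda>us. tensor w (take 4 us) * jet i j (tensor w' (drop 4 us) * c)) us)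
    = alt_sum (\<lambda>us. jet i j (c * tensor w' (take 4 us)) * tensor w (drop 4 us)) us"
    unfolding alt_sum_reindex[OF \<rho>, symmetric]
    by (rule alt_sum_cong) (simp add: swap us mult.commute)
  also have "\<dots> = 0"
  proof -
    have "alt_mean (\<lambda>us. jet i j (c * tensor w' (take 4 us)) * tensor w (drop 4 us)) us
      = alt_mean (\<lambda>us. jet i j (alt_mean (\<lambda>us. c * tensor w' us) (take 4 us)) * tensor w (drop 4 us)) us"
      using alt_mean_block[where H = "\<lambda>x zs. jet i j x * tensor w zs" and k = 4 and xs = us]
      by (simp add: jet_add jet_const us ring_distribs mult.assoc)
    also have "\<dots> = alt_mean (\<lambda>us. jets.deriv (i, j) (jets.M_word w' (\<lambda>_. c)) (take 4 us) * tensor w (drop 4 us)) us"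
    proof (rule alt_mean_cong)
      fix ys :: "U list" assume "length ys = length us"
      then have "jets.M_word w' (\<lambda>_. c) (take 4 ys) = alt_mean (\<lambda>us. c * tensor w' us) (take 4 ys)"
        using w' us by (subst M_word_eq_alt_mean) auto
      then show "jet i j (alt_mean (\<lambda>us. c * tensor w' us) (take 4 ys)) * tensor w (drop 4 ys)
        = jets.deriv (i, j) (jets.M_word w' (\<lambda>_. c)) (take 4 ys) * tensor w (drop 4 ys)"
        by (simp add: deriv_apply)
    qed
    also have "\<dots> = jets.M_word w (jets.deriv (i, j) (jets.M_word w' (\<lambda>_. c))) us"
      using w us by (subst M_word_eq_alt_mean) auto
    also have "\<dots> = 0"
    proof -
      have "i + j \<le> 2" using p by (auto simp: jets5_def)
      moreover have "card (set jets5) = 5" by (simp add: jets5_def)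
      ultimately show ?thesis
        using w w' by (subst jets.M_word_deriv_M_word_eq_0[of w w' "set jets5"]) auto
    qed
    finally show ?thesis
      using fact_alt_mean[of us "\<lambda>us. jet i j (c * tensor w' (take 4 us)) * tensor w (drop 4 us)"] by simp
  qed
  finally show ?thesis by (simp add: signed_def split: if_splits)
qed

text \<open>
  The determinant as a sum in which the last argument is singled out. Permuting the jets instead of
  the arguments keeps the first four arguments in order.
\<close>

lemma jet_det_snoc:
  assumes "length us = 4"
  shows "jet_det (us @ [g]) = const 3 * (\<Sum>\<sigma> | \<sigma> permutes {..<5}. signed \<sigma>
    (tensor (butlast (permute_list \<sigma> jets5)) us *
      jet (fst (last (permute_list \<sigma> jets5))) (snd (last (permute_list \<sigma> jets5))) g))"
proof -
  have "alt_sum (tensor jets5) (us @ [g]) = (\<Sum>\<sigma> | \<sigma> permutes {..<5}. signed (inv \<sigma>) (tensor jets5 (permute_list (inv \<sigma>) (us @ [g]))))"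
    unfolding alt_sum_def using assms sum_permutations_inverse[of _ "{..<5}"] by simp
  also have "\<dots> = (\<Sum>\<sigma> | \<sigma> permutes {..<5}. signed \<sigma>
    (tensor (butlast (permute_list \<sigma> jets5)) us *
      jet (fst (last (permute_list \<sigma> jets5))) (snd (last (permute_list \<sigma> jets5))) g))"
  proof (intro sum.cong refl)
    fix \<sigma> :: "nat \<Rightarrow> nat" assume "\<sigma> \<in> {\<sigma>. \<sigma> permutes {..<5}}"
    then have \<sigma>: "\<sigma> permutes {..<5}" by simp
    have length_jets5: "length jets5 = 5" by (simp add: jets5_def)
    have "tensor jets5 (permute_list (inv \<sigma>) (us @ [g])) =
      tensor (permute_list \<sigma> jets5) (permute_list \<sigma> (permute_list (inv \<sigma>) (us @ [g])))"
      using \<sigma> assms length_jets5 by (intro tensor_permute[symmetric]) auto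
    also have "permute_list \<sigma> (permute_list (inv \<sigma>) (us @ [g])) = us @ [g]"
      using \<sigma> assms by (subst permute_list_compose[symmetric]) (auto simp: permutes_inv_o)
    also have "tensor (permute_list \<sigma> jets5) (us @ [g]) = tensor (butlast (permute_list \<sigma> jets5)) us *
      jet (fst (last (permute_list \<sigma> jets5))) (snd (last (permute_list \<sigma> jets5))) g"
    proof -
      have "permute_list \<sigma> jets5 \<noteq> []" by (simp add: length_jets5 flip: length_greater_0_conv)
      then show ?thesis
        using tensor_snoc[of "butlast (permute_list \<sigma> jets5)" us "last (permute_list \<sigma> jets5)" g] assms length_jets5
        by simp
    qed
    finally show "signed (inv \<sigma>) (tensor jets5 (permute_list (inv \<sigma>) (us @ [g]))) = signed \<sigma>
      (tensor (butlast (permute_list \<sigma> jets5)) us *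
      jet (fst (last (permute_list \<sigma> jets5))) (snd (last (permute_list \<sigma> jets5))) g)"
      using \<sigma> by (simp add: signed_def sign_inverse permutation_lessThan)
  qed
  finally show ?thesis by (simp add: jet_det_def)
qed

lemma alt_sum_jet_det_jet_det:
  assumes us: "length us = 8"
  shows "alt_sum (\<lambda>us. jet_det (take 4 us @ [jet_det (drop 4 us @ [v])])) us = 0"
proof -
  define P where "P = {\<sigma>. \<sigma> permutes {..<5::nat}}"
  define b where "b = (\<lambda>\<sigma>. butlast (permute_list \<sigma> jets5))"
  define l where "l = (\<lambda>\<sigma>. last (permute_list \<sigma> jets5))"
  have bl: "distinct (b \<sigma>) \<and> length (b \<sigma>) = 4 \<and> set (b \<sigma>) \<subseteq> set jets5 \<and> l \<sigma> \<in> set jets5" if "\<sigma> \<in> P" for \<sigma>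
  proof -
    have "\<sigma> permutes {..<length jets5}" using that by (simp add: P_def length_jets5)
    then have "distinct (permute_list \<sigma> jets5)" "set (permute_list \<sigma> jets5) = set jets5" "length (permute_list \<sigma> jets5) = 5"
      by (simp_all add: length_jets5) (simp add: jets5_def)
    moreover have "permute_list \<sigma> jets5 \<noteq> []"
      by (metis length_0_conv length_jets5 length_permute_list zero_neq_numeral)
    ultimately show ?thesis
      unfolding b_def l_def using last_in_set[of "permute_list \<sigma> jets5"] in_set_butlastD[of _ "permute_list \<sigma> jets5"]
      by (auto intro: distinct_butlast)
  qed
  have jet_sum: "jet i j (sum f A) = (\<Sum>x\<in>A. jet i j (f x))" for i j and f :: "(nat \<Rightarrow> nat) \<Rightarrow> U" and A
    using jet_add[of i j 0 0] by (induction A rule: infinite_finite_induct) (auto simp: jet_add)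
  have jet_signed: "jet i j (signed \<sigma> x) = signed \<sigma> (jet i j x)" for i j \<sigma> x
    using jet_add[of i j x "- x"] jet_add[of i j 0 0]
    by (simp add: signed_def eq_neg_iff_add_eq_0 add.commute)
  have expand: "signed \<sigma> (T * jet i j (const 3 * (\<Sum>\<sigma>'\<in>P. signed \<sigma>' (f \<sigma>')))) =
    const 3 * (\<Sum>\<sigma>'\<in>P. signed \<sigma> (signed \<sigma>' (T * jet i j (f \<sigma>'))))" for \<sigma> T i j f
  proof -
    have "T * jet i j (const 3 * (\<Sum>\<sigma>'\<in>P. signed \<sigma>' (f \<sigma>'))) =
      const 3 * (T * jet i j (\<Sum>\<sigma>'\<in>P. signed \<sigma>' (f \<sigma>')))"
      by (simp only: jet_const mult.left_commute)
    also have "T * jet i j (\<Sum>\<sigma>'\<in>P. signed \<sigma>' (f \<sigma>')) = (\<Sum>\<sigma>'\<in>P. signed \<sigma>' (T * jet i j (f \<sigma>')))"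
      by (simp only: jet_sum jet_signed sum_distrib_left signed_mult_right)
    finally show ?thesis
      by (simp only: signed_sum flip: signed_mult_right)
  qed
  have "alt_sum (\<lambda>us. jet_det (take 4 us @ [jet_det (drop 4 us @ [v])])) us =
    alt_sum (\<lambda>us. const 3 * (\<Sum>\<sigma>\<in>P. const 3 * (\<Sum>\<sigma>'\<in>P. signed \<sigma> (signed \<sigma>'
      (tensor (b \<sigma>) (take 4 us) * jet (fst (l \<sigma>)) (snd (l \<sigma>))
         (tensor (b \<sigma>') (drop 4 us) * jet (fst (l \<sigma>')) (snd (l \<sigma>')) v)))))) us"
  proof (rule alt_sum_cong)
    fix ys :: "U list" assume "length ys = length us"
    then have "length (take 4 ys) = 4" "length (drop 4 ys) = 4" using us by auto
    then show "jet_det (take 4 ys @ [jet_det (drop 4 ys @ [v])]) = const 3 * (\<Sum>\<sigma>\<in>P. const 3 * (\<Sum>\<sigma>'\<in>P. signed \<sigma> (signed \<sigma>'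
      (tensor (b \<sigma>) (take 4 ys) * jet (fst (l \<sigma>)) (snd (l \<sigma>))
         (tensor (b \<sigma>') (drop 4 ys) * jet (fst (l \<sigma>')) (snd (l \<sigma>')) v)))))"
      by (simp only: jet_det_snoc P_def[symmetric] expand b_def l_def)
  qed
  also have "\<dots> = const 3 * (\<Sum>\<sigma>\<in>P. const 3 * (\<Sum>\<sigma>'\<in>P. signed \<sigma> (signed \<sigma>' (alt_sum (\<lambda>us.
      (tensor (b \<sigma>) (take 4 us) * jet (fst (l \<sigma>)) (snd (l \<sigma>))
         (tensor (b \<sigma>') (drop 4 us) * jet (fst (l \<sigma>')) (snd (l \<sigma>')) v))) us))))"
    by (simp only: alt_sum_additive[of "\<lambda>x. const 3 * x", OF distrib_left] alt_sum_sum alt_sum_signed)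
  also have "\<dots> = const 3 * (\<Sum>\<sigma>\<in>P. const 3 * (\<Sum>\<sigma>'\<in>P. 0))"
    using bl us by (intro arg_cong[of _ _ "(*) _"] sum.cong refl)
      (simp add: alt_sum_tensor_jet_tensor_eq_0)
  finally show ?thesis by simp
qed

lemma compose_last_s5:
  assumes as: "length as = 9" "set as \<subseteq> Vect2_0"
  shows "(\<Sum>\<sigma> | \<sigma> permutes {..<8}. signed \<sigma> (compose_last 5 s_std (permute_list \<sigma> as))) = 0"
proof -
  obtain us where us: "as = map ham us" using as Vect2_0_list by blast
  then have "length us = Suc 8" using as by simp
  then obtain vs v where vs: "us = vs @ [v]" "length vs = 8" by (metis length_Suc_conv_rev)
  have "(\<Sum>\<sigma> | \<sigma> permutes {..<8}. signed \<sigma> (compose_last 5 s_std (permute_list \<sigma> as)))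
    = alt_sum (\<lambda>vs. ham (jet_det (take 4 vs @ [jet_det (drop 4 vs @ [v])]))) vs"
    unfolding alt_sum_def vs(2)
  proof (intro sum.cong refl arg_cong[of _ _ "signed _"])
    fix \<sigma> :: "nat \<Rightarrow> nat" assume "\<sigma> \<in> {\<sigma>. \<sigma> permutes {..<8}}"
    then have \<sigma>: "\<sigma> permutes {..<8}" by simp
    then have "\<sigma> permutes {..<length us}" using vs by (auto intro: permutes_subset)
    then have p: "permute_list \<sigma> as = map ham (permute_list \<sigma> vs @ [v])"
      unfolding us using \<sigma> vs by (simp only: permute_list_map) (simp add: permute_list_snoc)
    define xs where "xs = permute_list \<sigma> vs"
    have xs: "length xs = 8" using vs by (simp add: xs_def)
    have "compose_last 5 s_std (map ham (xs @ [v])) = ham (jet_det (take 4 xs @ [jet_det (drop 4 xs @ [v])]))"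
      unfolding compose_last_def using s5_ham[of "drop 4 xs @ [v]"] s5_ham[of "take 4 xs @ [jet_det (drop 4 xs @ [v])]"] xs
      by (simp add: eval_nat_numeral take_map drop_map)
    then show "compose_last 5 s_std (permute_list \<sigma> as) =
      ham (jet_det (take 4 (permute_list \<sigma> vs) @ [jet_det (drop 4 (permute_list \<sigma> vs) @ [v])]))"
      unfolding p xs_def .
  qed
  also have "\<dots> = ham (alt_sum (\<lambda>us. jet_det (take 4 us @ [jet_det (drop 4 us @ [v])])) vs)"
    by (rule alt_sum_additive) (rule ham_add_left)
  also have "\<dots> = ham 0" by (simp add: alt_sum_jet_det_jet_det vs)
  also have "\<dots> = 0" by (rule ext) (simp add: ham_apply)
  finally show ?thesis .
qed

lemma left_commutative_s5: "left_commutative cscale Vect2_0 5 s_std"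
  unfolding left_commutative_def using compose_last_s5 skew_operation_s_std[of 5] s5_closed by auto

text \<open>
  The sum over \<open>Sym\<^sub>9\<close> averages the vanishing sums over \<open>Sym\<^sub>8\<close>.
\<close>

lemma homotopical_lie_s5: "homotopical_lie cscale Vect2_0 5 s_std"
  unfolding homotopical_lie_def
proof (intro conjI allI impI)
  show "skew_operation cscale Vect2_0 5 s_std"
    using skew_operation_s_std[of 5] s5_closed by auto
  fix as :: "oper list" assume as: "length as = 2 * 5 - 1 \<and> set as \<subseteq> Vect2_0"
  have "alt_sum (compose_last 5 s_std) as = 0"
  proof
    fix f
    have "alt_sum (\<lambda>ys. compose_last 5 s_std ys f) as = 0"
    proof (rule alt_sum_eq_0_if_block[where k = 8])
      fix ys :: "oper list" assume "length ys = length as" "mset ys = mset as"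
      then have "(\<Sum>\<tau> | \<tau> permutes {..<8}. signed \<tau> (compose_last 5 s_std (permute_list \<tau> ys))) f = 0"
        using as compose_last_s5[of ys] mset_eq_setD[of ys as] by simp
      then show "(\<Sum>\<tau> | \<tau> permutes {..<8}. signed \<tau> (compose_last 5 s_std (permute_list \<tau> ys) f)) = 0"
        by (simp add: sum_apply signed_apply)
    qed (use as in simp)
    then show "alt_sum (compose_last 5 s_std) as f = 0 f" by (simp add: alt_sum_apply)
  qed
  then show "(\<Sum>\<sigma> | \<sigma> permutes {..<2 * 5 - 1}. signed \<sigma> (compose_last 5 s_std (permute_list \<sigma> as))) = 0"
    using as by (simp add: alt_sum_def)
qed

section \<open>The cocycle condition\<close>

abbreviation act :: "U \<Rightarrow> oper list \<Rightarrow> U" where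
  "act f Xs \<equiv> foldl (\<lambda>g X. X g) f Xs"

lemma act_diff: "set Xs \<subseteq> Vect2_0 \<Longrightarrow> act (f - g) Xs = act f Xs - act g Xs"
  by (induction Xs arbitrary: f g) (auto simp: Vect2_0_diff)

text \<open>
  Any product of all six arguments, in any fixed order, alternates to \<open>\<plusminus> s\<^sub>6 = 0\<close>. The next two lemmas
  expand the terms of the cocycle condition into such products.
\<close>

lemma alt_sum_word_6:
  assumes "mset v = mset [0..<6]" "length as = 6" "set as \<subseteq> Vect2_0"
  shows "alt_sum (\<lambda>xs. act f (map ((!) xs) v)) as = 0"
proof -
  obtain \<rho> where \<rho>: "\<rho> permutes {..<6}" "\<And>xs :: oper list. length xs = 6 \<Longrightarrow> map ((!) xs) v = permute_list \<rho> xs"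
    using map_nth_permutation[OF assms(1)] by blast
  have "alt_sum (\<lambda>xs. act f (map ((!) xs) v)) as = alt_sum (\<lambda>xs. act f (permute_list \<rho> xs)) as"
    using assms \<rho> by (intro alt_sum_cong) simp
  also have "\<dots> = signed \<rho> (alt_sum (act f) as)"
    using \<rho> assms by (intro alt_sum_reindex) simp
  also have "alt_sum (act f) as = s_std as f"
    using assms(2) by (subst s_std_apply) auto
  also have "\<dots> = 0" using s6_eq_0[OF assms(2,3)] by simp
  finally show ?thesis by simp
qed

text \<open>
  For each fixed \<open>\<tau>\<close> in the outer \<open>s\<^sub>5\<close>, the bracket expands into two products of all six arguments.
\<close>

lemma alt_sum_bracket_last:
  assumes as: "length as = 6" "set as \<subseteq> Vect2_0"
  shows "alt_sum (\<lambda>xs. s_std (take 4 xs @ [comm (xs ! 4) (xs ! 5)]) f) as = 0"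
proof -
  have "\<exists>v v'. mset v = mset [0..<6] \<and> mset v' = mset [0..<6] \<and>
    (\<forall>xs. length xs = 6 \<and> set xs \<subseteq> Vect2_0 \<longrightarrow> act f (permute_list \<tau> (take 4 xs @ [comm (xs ! 4) (xs ! 5)])) =
      act f (map ((!) xs) v) - act f (map ((!) xs) v'))" if \<tau>: "\<tau> permutes {..<5}" for \<tau>
  proof -
    have "\<tau> permutes {..<length [0::nat,1,2,3] + 1 + length ([] :: nat list)}"
      using \<tau> by (simp add: eval_nat_numeral)
    from permute_list_slot[OF this]
    obtain cs ds where cd: "\<And>x. permute_list \<tau> ([0,1,2,3] @ x # []) = cs @ (x::nat) # ds"
      by blast
    have l5: "length [0::nat,1,2,3,4] = 5" by simp
    have \<tau>': "\<tau> permutes {..<length [0::nat,1,2,3,4]}" unfolding l5 by (rule \<tau>)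
    have m: "mset (cs @ ds) = mset [0,1,2,3]"
      using arg_cong[OF cd[of 4], of mset] mset_permute_list[OF \<tau>'] by simp
    \<comment> \<open>the letter 4 stands for the bracket and is replaced by its two arguments in both orders\<close>
    define v where "v = cs @ [4, 5] @ ds"
    define v' where "v' = cs @ [5, 4] @ ds"
    have upt: "[0..<6] = [0,1,2,3,4,5::nat]" by (simp add: upt_rec)
    have "mset v = mset [0..<6]" "mset v' = mset [0..<6]"
      using m unfolding upt by (simp_all add: v_def v'_def)
    moreover have "act f (permute_list \<tau> (take 4 xs @ [comm (xs ! 4) (xs ! 5)])) =
      act f (map ((!) xs) v) - act f (map ((!) xs) v')" if xs: "length xs = 6" "set xs \<subseteq> Vect2_0" for xs
    proof -
      define h where "h = (\<lambda>i. if i = 4 then comm (xs ! 4) (xs ! 5) else xs ! i)"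
      have "set cs \<union> set ds = {0,1,2,3}" using mset_eq_setD[OF m] by (simp only: set_append list.set)
      then have csds: "set cs \<subseteq> {0,1,2,3}" "set ds \<subseteq> {0,1,2,3}" by blast+
      have "take 4 xs @ [comm (xs ! 4) (xs ! 5)] = map h [0,1,2,3,4]"
      proof -
        have "take 4 xs = map ((!) xs) [0..<4]" using xs by (intro nth_equalityI) auto
        moreover have "[0..<4] = [0,1,2,3::nat]" by (simp add: upt_rec)
        ultimately show ?thesis by (simp add: h_def)
      qed
      then have "permute_list \<tau> (take 4 xs @ [comm (xs ! 4) (xs ! 5)]) = map h (cs @ 4 # ds)"
        using cd[of 4] permute_list_map[OF \<tau>', of h] by simp
      also have "\<dots> = map ((!) xs) cs @ comm (xs ! 4) (xs ! 5) # map ((!) xs) ds"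
        using csds by (auto simp: h_def)
      finally have "permute_list \<tau> (take 4 xs @ [comm (xs ! 4) (xs ! 5)]) =
        map ((!) xs) cs @ comm (xs ! 4) (xs ! 5) # map ((!) xs) ds" .
      moreover have "set (map ((!) xs) ds) \<subseteq> Vect2_0"
      proof -
        have "xs ! i \<in> Vect2_0" if "i \<in> {0,1,2,3}" for i
          using that xs by (intro subsetD[OF xs(2)] nth_mem) auto
        then show ?thesis using csds by auto
      qed
      ultimately show ?thesis
        by (simp add: v_def v'_def comm_def rcomp_def act_diff)
    qed
    ultimately show ?thesis by blast
  qed
  then obtain v v' where v: "\<And>\<tau>. \<tau> permutes {..<5} \<Longrightarrow> mset (v \<tau>) = mset [0..<6] \<and> mset (v' \<tau>) = mset [0..<6] \<and>
    (\<forall>xs. length xs = 6 \<and> set xs \<subseteq> Vect2_0 \<longrightarrow> act f (permute_list \<tau> (take 4 xs @ [comm (xs ! 4) (xs ! 5)])) =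
      act f (map ((!) xs) (v \<tau>)) - act f (map ((!) xs) (v' \<tau>)))"
    by metis
  have "alt_sum (\<lambda>xs. s_std (take 4 xs @ [comm (xs ! 4) (xs ! 5)]) f) as =
    alt_sum (\<lambda>xs. \<Sum>\<tau> | \<tau> permutes {..<5}. signed \<tau> (act f (map ((!) xs) (v \<tau>)) - act f (map ((!) xs) (v' \<tau>)))) as"
  proof (rule alt_sum_cong)
    fix xs assume "length xs = length as" "mset xs = mset as"
    then have xs: "length xs = 6" "set xs \<subseteq> Vect2_0" using as mset_eq_setD by auto
    then have "s_std (take 4 xs @ [comm (xs ! 4) (xs ! 5)]) f =
      (\<Sum>\<tau> | \<tau> permutes {..<5}. signed \<tau> (act f (permute_list \<tau> (take 4 xs @ [comm (xs ! 4) (xs ! 5)]))))"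
      by (subst s_std_apply) (simp_all add: alt_sum_def)
    also have "\<dots> = (\<Sum>\<tau> | \<tau> permutes {..<5}. signed \<tau> (act f (map ((!) xs) (v \<tau>)) - act f (map ((!) xs) (v' \<tau>))))"
      using v xs by (intro sum.cong refl) simp
    finally show "s_std (take 4 xs @ [comm (xs ! 4) (xs ! 5)]) f = \<dots>" .
  qed
  also have "\<dots> = 0"
    unfolding alt_sum_sum alt_sum_signed alt_sum_diff
    using v as by (intro sum.neutral) (simp add: alt_sum_word_6)
  finally show ?thesis .
qed

lemma alt_sum_bracket_s5:
  assumes as: "length as = 6" "set as \<subseteq> Vect2_0"
  shows "alt_sum (\<lambda>xs. comm (xs ! 5) (s_std (take 5 xs)) f) as = 0"
proof -
  have upt: "[0..<6] = [0..<5] @ [5]" by (simp add: upt_rec)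
  have "alt_sum (\<lambda>xs. comm (xs ! 5) (s_std (take 5 xs)) f) as =
    alt_sum (\<lambda>xs. \<Sum>\<tau> | \<tau> permutes {..<5}. signed \<tau> (act f (map ((!) xs) (5 # permute_list \<tau> [0..<5])) -
       act f (map ((!) xs) (permute_list \<tau> [0..<5] @ [5])))) as"
  proof (rule alt_sum_cong)
    fix xs assume "length xs = length as" "mset xs = mset as"
    then have xs: "length xs = 6" "set xs \<subseteq> Vect2_0" using as mset_eq_setD by auto
    have x5: "xs ! 5 \<in> Vect2_0" using xs by (intro subsetD[OF xs(2)] nth_mem) auto
    have t: "take 5 xs = map ((!) xs) [0..<5]"
      using xs by (intro nth_equalityI) auto
    have s: "s_std (take 5 xs) g = (\<Sum>\<tau> | \<tau> permutes {..<5}. signed \<tau> (act g (map ((!) xs) (permute_list \<tau> [0..<5]))))"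
      for g
    proof -
      have "s_std (take 5 xs) g = alt_sum (act g) (take 5 xs)"
        using xs by (intro s_std_apply) auto
      then show ?thesis unfolding t alt_sum_map by (simp add: alt_sum_def)
    qed
    have 1: "(xs ! 5) (s_std (take 5 xs) f) = alt_sum (\<lambda>ys. (xs ! 5) (act f ys)) (take 5 xs)"
      using xs x5 by (subst s_std_apply) (auto simp: alt_sum_additive Vect2_0_add)
    then have 1: "(xs ! 5) (s_std (take 5 xs) f) = (\<Sum>\<tau> | \<tau> permutes {..<5}. signed \<tau>
      (act f (map ((!) xs) (permute_list \<tau> [0..<5] @ [5]))))"
      unfolding 1 unfolding t alt_sum_map by (simp add: alt_sum_def)
    have "comm (xs ! 5) (s_std (take 5 xs)) f = s_std (take 5 xs) ((xs ! 5) f) - (xs ! 5) (s_std (take 5 xs) f)"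
      by (simp only: comm_def rcomp_def fun_diff_def)
    also have "\<dots> = (\<Sum>\<tau> | \<tau> permutes {..<5}. signed \<tau> (act f (map ((!) xs) (5 # permute_list \<tau> [0..<5])) -
       act f (map ((!) xs) (permute_list \<tau> [0..<5] @ [5]))))"
      unfolding 1 unfolding s by (simp add: signed_diff sum_subtractf)
    finally show "comm (xs ! 5) (s_std (take 5 xs)) f = \<dots>" .
  qed
  also have "\<dots> = (\<Sum>\<tau> | \<tau> permutes {..<5}. signed \<tau> (0 - 0))"
    unfolding alt_sum_sum alt_sum_signed alt_sum_diff
  proof (intro sum.cong refl arg_cong[of _ _ "signed _"] arg_cong2[of _ _ _ _ "(-)"] alt_sum_word_6 as)
    fix \<tau> :: "nat \<Rightarrow> nat" assume "\<tau> \<in> {\<tau>. \<tau> permutes {..<5}}"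
    then have "mset (permute_list \<tau> [0..<5]) = mset [0..<5]" by (intro mset_permute_list) simp
    then show "mset (5 # permute_list \<tau> [0..<5]) = mset [0..<6]"
      and "mset (permute_list \<tau> [0..<5] @ [5]) = mset [0..<6]"
      unfolding upt by simp_all
  qed
  finally show ?thesis by simp
qed

lemma comm_minus_right: "X \<in> Vect2_0 \<Longrightarrow> comm X (- Y) f = - comm X Y f"
  using Vect2_0_diff[of X 0 "Y f"] Vect2_0_diff[of X 0 0]
  by (simp add: comm_def rcomp_def)

lemma comm_swap: "comm X Y = - comm Y X"
  by (simp add: comm_def)

lemma s_std_5_swap:
  fixes a b c d e :: oper
  shows "s_std [a, b, c, d, e] = - s_std [b, a, c, d, e]"
    and "s_std [a, b, c, d, e] = - s_std [a, c, b, d, e]"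
    and "s_std [a, b, c, d, e] = - s_std [a, b, d, c, e]"
    and "s_std [a, b, c, d, e] = - s_std [a, b, c, e, d]"
  using alt_sum_swap_adjacent[of _ "[]" a b "[c, d, e]"] alt_sum_swap_adjacent[of _ "[a]" b c "[d, e]"]
    alt_sum_swap_adjacent[of _ "[a, b]" c d "[e]"] alt_sum_swap_adjacent[of _ "[a, b, c]" d e "[]"]
  unfolding skew_poly_eq_alt_sum append_Cons append_Nil by blast+

lemma s_std_5_minus:
  assumes "x \<in> Vect2_0" "set ys \<subseteq> Vect2_0" "length ys = 4"
  shows "s_std (- x # ys) = - s_std (x # ys)"
proof -
  have "skew_operation cscale Vect2_0 5 s_std"
    by (rule skew_operation_s_std) (auto intro: s5_closed)
  then have scale: "\<forall>as c a bs. length as + 1 + length bs = 5 \<and> set as \<union> {a} \<union> set bs \<subseteq> Vect2_0 \<longrightarrow>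
     s_std (as @ cscale c a # bs) = cscale c (s_std (as @ a # bs))"
    unfolding skew_operation_def by (elim conjE)
  note scale[THEN spec[of _ "[]"], THEN spec[of _ "-1"], THEN spec[of _ x], THEN spec[of _ ys]]
  moreover have "cscale (-1) X = - X" for X
  proof -
    have "const (-1) = -1" by (simp add: const_def one_pCons)
    then show ?thesis by (simp add: fun_eq_iff cscale_apply)
  qed
  ultimately show ?thesis using assms by simp
qed

text \<open>
  The second sum of the cocycle condition. Its terms are the values on the cosets of \<open>Sym\<^sub>5\<close> in \<open>Sym\<^sub>6\<close>
  of a function whose alternating sum over \<open>Sym\<^sub>6\<close> is 0.
\<close>

lemma sum_bracket_s5_eq_0:
  fixes A :: "nat \<Rightarrow> oper"
  assumes A: "\<And>i. i < 6 \<Longrightarrow> A i \<in> Vect2_0"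
  shows "comm (A 0) (s_std [A 1, A 2, A 3, A 4, A 5]) f - comm (A 1) (s_std [A 0, A 2, A 3, A 4, A 5]) f +
    comm (A 2) (s_std [A 0, A 1, A 3, A 4, A 5]) f - comm (A 3) (s_std [A 0, A 1, A 2, A 4, A 5]) f +
    comm (A 4) (s_std [A 0, A 1, A 2, A 3, A 5]) f - comm (A 5) (s_std [A 0, A 1, A 2, A 3, A 4]) f = 0"
proof -
  define as where "as = map A [0..<6]"
  have as: "length as = 6" "set as \<subseteq> Vect2_0" using A by (auto simp: as_def)
  define F where "F = (\<lambda>xs. comm (xs ! 5) (s_std (take 5 xs)) f)"
  \<comment> \<open>\<open>F\<close> is skew in its first five arguments if the last one is additive; \<open>F'\<close> is so everywhere\<close>
  define F' where "F' = (\<lambda>xs. if set xs \<subseteq> Vect2_0 then F xs else 0)"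
  have "alt_sum F' as = alt_sum F as"
    using as by (intro alt_sum_cong) (auto simp: F'_def dest: mset_eq_setD)
  then have 0: "alt_sum F' as = 0" using alt_sum_bracket_s5[OF as, of f] by (simp add: F_def)
  have inv: "F' (permute_list \<tau> ys) = signed \<tau> (F' ys)"
    if \<tau>: "\<tau> permutes {..<5}" and ys: "length ys = 6" for \<tau> ys
  proof -
    have \<tau>': "\<tau> permutes {..<length ys}" using \<tau> by (rule permutes_subset) (simp add: ys)
    obtain zs z where z: "ys = zs @ [z]" "length zs = 5" using ys length_Suc_conv_rev[of ys 5] by auto
    have p: "permute_list \<tau> ys = permute_list \<tau> zs @ [z]" using z \<tau> by (simp add: permute_list_snoc)
    have "s_std (permute_list \<tau> zs) = signed \<tau> (s_std zs)"
      using z \<tau> by (simp add: skew_poly_eq_alt_sum alt_sum_permute)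
    moreover have "comm z (signed \<tau> Y) f = signed \<tau> (comm z Y f)" if "z \<in> Vect2_0" for Y
      using that by (simp add: signed_def comm_minus_right)
    ultimately have "F (permute_list \<tau> ys) = signed \<tau> (F ys)" if "set ys \<subseteq> Vect2_0"
      unfolding F_def p using that z by (auto simp: nth_append)
    moreover have "set (permute_list \<tau> ys) = set ys" using \<tau>' by simp
    ultimately show ?thesis by (simp add: F'_def)
  qed
  have as': "as = [A 0, A 1, A 2, A 3, A 4, A 5]" by (simp add: as_def upt_6)
  have "F' [A 0, A 1, A 2, A 3, A 4, A 5] - F' [A 5, A 1, A 2, A 3, A 4, A 0] - F' [A 0, A 5, A 2, A 3, A 4, A 1]
    - F' [A 0, A 1, A 5, A 3, A 4, A 2] - F' [A 0, A 1, A 2, A 5, A 4, A 3] - F' [A 0, A 1, A 2, A 3, A 5, A 4] = 0"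
    by (rule sum_const_eq_0[of _ 5], rule trans[OF alt_sum_cosets_6[of F', OF inv, symmetric]])
      (simp_all only: 0 flip: as')
  moreover have "F' [A p, A q, A r, A s, A t, A i] = F [A p, A q, A r, A s, A t, A i]"
    if "{p, q, r, s, t, i} \<subseteq> {..<6}" for p q r s t i
    using that A by (simp add: F'_def)
  ultimately have E: "F [A 0, A 1, A 2, A 3, A 4, A 5] - F [A 5, A 1, A 2, A 3, A 4, A 0] - F [A 0, A 5, A 2, A 3, A 4, A 1]
    - F [A 0, A 1, A 5, A 3, A 4, A 2] - F [A 0, A 1, A 2, A 5, A 4, A 3] - F [A 0, A 1, A 2, A 3, A 5, A 4] = 0"
    by simp
  define T where "T = (\<lambda>p q r s t i. comm (A i) (s_std [A p, A q, A r, A s, A t]) f)"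
  have T1: "T p q r s t i = - T q p r s t i" if "i < 6" for p q r s t i
    unfolding T_def by (subst s_std_5_swap(1)) (rule comm_minus_right[OF A[OF that]])
  have T2: "T p q r s t i = - T p r q s t i" if "i < 6" for p q r s t i
    unfolding T_def by (subst s_std_5_swap(2)) (rule comm_minus_right[OF A[OF that]])
  have T3: "T p q r s t i = - T p q s r t i" if "i < 6" for p q r s t i
    unfolding T_def by (subst s_std_5_swap(3)) (rule comm_minus_right[OF A[OF that]])
  have T4: "T p q r s t i = - T p q r t s i" if "i < 6" for p q r s t i
    unfolding T_def by (subst s_std_5_swap(4)) (rule comm_minus_right[OF A[OF that]])
  have FT: "F [A p, A q, A r, A s, A t, A i] = T p q r s t i" for p q r s t i
    by (simp add: F_def T_def)
  have sort: "q < p \<Longrightarrow> i < 6 \<Longrightarrow> T p q r s t i = - T q p r s t i"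
    "r < q \<Longrightarrow> i < 6 \<Longrightarrow> T p q r s t i = - T p r q s t i"
    "s < r \<Longrightarrow> i < 6 \<Longrightarrow> T p q r s t i = - T p q s r t i"
    "t < s \<Longrightarrow> i < 6 \<Longrightarrow> T p q r s t i = - T p q r t s i" for p q r s t i
    by (rule T1 T2 T3 T4; assumption)+
  have "T 0 1 2 3 4 5 - T 5 1 2 3 4 0 - T 0 5 2 3 4 1 - T 0 1 5 3 4 2 - T 0 1 2 5 4 3 - T 0 1 2 3 5 4 = 0"
    using E unfolding FT .
  moreover have "T 5 1 2 3 4 0 = T 1 2 3 4 5 0" "T 0 5 2 3 4 1 = - T 0 2 3 4 5 1" "T 0 1 5 3 4 2 = T 0 1 3 4 5 2"
    "T 0 1 2 5 4 3 = - T 0 1 2 4 5 3"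
    by (simp_all add: sort)
  ultimately show ?thesis unfolding T_def by (simp add: algebra_simps)
qed

text \<open>
  The first sum of the cocycle condition, with the opposite sign. Going down from \<open>Sym\<^sub>6\<close> to \<open>Sym\<^sub>5\<close>
  and from \<open>Sym\<^sub>5\<close> to \<open>Sym\<^sub>4\<close> lists all ordered pairs of arguments in the bracket, so each of the
  15 terms appears twice.
\<close>

lemma sum_s5_bracket_eq_0:
  fixes A :: "nat \<Rightarrow> oper" and f :: U
  assumes A: "\<And>i. i < 6 \<Longrightarrow> A i \<in> Vect2_0"
  defines "T \<equiv> \<lambda>p q r s i j. s_std [comm (A i) (A j), A p, A q, A r, A s] f"
  shows "T 2 3 4 5 0 1 - T 1 3 4 5 0 2 + T 1 2 4 5 0 3 - T 1 2 3 5 0 4 + T 1 2 3 4 0 5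
    + T 0 3 4 5 1 2 - T 0 2 4 5 1 3 + T 0 2 3 5 1 4 - T 0 2 3 4 1 5 + T 0 1 4 5 2 3
    - T 0 1 3 5 2 4 + T 0 1 3 4 2 5 + T 0 1 2 5 3 4 - T 0 1 2 4 3 5 + T 0 1 2 3 4 5 = 0" (is "?S = 0")
proof -
  define as where "as = [A 0, A 1, A 2, A 3, A 4, A 5]"
  have as: "length as = 6" "set as \<subseteq> Vect2_0" using A by (auto simp: as_def)
  define F where "F = (\<lambda>xs. s_std (take 4 xs @ [comm (xs ! 4) (xs ! 5)]) f)"
  \<comment> \<open>\<open>F\<close> is skew in its first four arguments only; \<open>F5\<close> is alternated over the first five\<close>
  define F5 where "F5 = (\<lambda>ys. alt_sum (\<lambda>zs. F (zs @ [last ys])) (butlast ys))"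
  have inv4: "F (permute_list \<tau> ys @ [z]) = signed \<tau> (F (ys @ [z]))"
    if \<tau>: "\<tau> permutes {..<4}" and ys: "length ys = 5" for \<tau> ys z
  proof -
    obtain zs y where y: "ys = zs @ [y]" "length zs = 4" using ys length_Suc_conv_rev[of ys 4] by auto
    have \<tau>': "\<tau> permutes {..<length (zs @ [comm y z])}" using \<tau> by (rule permutes_subset) (simp add: y)
    have "permute_list \<tau> ys @ [z] = permute_list \<tau> zs @ [y, z]" using y \<tau> by (simp add: permute_list_snoc)
    then have "F (permute_list \<tau> ys @ [z]) = s_std (permute_list \<tau> (zs @ [comm y z])) f"
      using y \<tau> by (simp add: F_def nth_append permute_list_snoc)
    also have "\<dots> = signed \<tau> (s_std (zs @ [comm y z]) f)"
      unfolding skew_poly_eq_alt_sum alt_sum_permute[OF \<tau>'] by (simp add: signed_apply)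
    also have "s_std (zs @ [comm y z]) f = F (ys @ [z])"
      using y by (simp add: F_def nth_append)
    finally show ?thesis .
  qed
  have inv5: "F5 (permute_list \<tau> ys) = signed \<tau> (F5 ys)"
    if \<tau>: "\<tau> permutes {..<5}" and ys: "length ys = 6" for \<tau> ys
  proof -
    obtain zs y where y: "ys = zs @ [y]" "length zs = 5" using ys length_Suc_conv_rev[of ys 5] by auto
    then show ?thesis using \<tau> by (simp add: F5_def permute_list_snoc alt_sum_permute)
  qed
  have "alt_sum F5 as = alt_sum (\<lambda>ys. \<Sum>\<tau> | \<tau> permutes {..<5}. signed \<tau> (F (permute_list \<tau> ys))) as"
  proof (rule alt_sum_cong)
    fix ys :: "oper list" assume "length ys = length as"
    then obtain zs y where y: "ys = zs @ [y]" "length zs = 5"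
      using as length_Suc_conv_rev[of ys 5] by auto
    then show "F5 ys = (\<Sum>\<tau> | \<tau> permutes {..<5}. signed \<tau> (F (permute_list \<tau> ys)))"
      by (auto simp: F5_def alt_sum_def permute_list_snoc intro!: sum.cong)
  qed
  also have "\<dots> = (\<Sum>\<tau> | \<tau> permutes {..<5::nat}. alt_sum F as)"
    using as by (intro alt_sum_average) simp
  also have "alt_sum F as = 0"
    unfolding F_def using as by (rule alt_sum_bracket_last)
  finally have 0: "alt_sum F5 as = 0" by simp
  have E: "F5 [A 0, A 1, A 2, A 3, A 4, A 5] - F5 [A 5, A 1, A 2, A 3, A 4, A 0] - F5 [A 0, A 5, A 2, A 3, A 4, A 1]
    - F5 [A 0, A 1, A 5, A 3, A 4, A 2] - F5 [A 0, A 1, A 2, A 5, A 4, A 3] - F5 [A 0, A 1, A 2, A 3, A 5, A 4] = 0"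
    by (rule sum_const_eq_0[of _ 5], rule trans[OF alt_sum_cosets_6[of F5, OF inv5, symmetric]])
      (simp_all only: 0 flip: as_def)
  have T0: "T p q r s i j = - T p q r s j i" if "{p, q, r, s, i, j} \<subseteq> {..<6}" for p q r s i j
  proof -
    have mem: "A p \<in> Vect2_0" "A q \<in> Vect2_0" "A r \<in> Vect2_0" "A s \<in> Vect2_0" "A i \<in> Vect2_0" "A j \<in> Vect2_0"
      using that A by auto
    then have c: "comm (A j) (A i) \<in> Vect2_0" by (auto simp: Vect2_0_eq ham_ham)
    then have "s_std [- comm (A j) (A i), A p, A q, A r, A s] f = - T p q r s j i"
      using mem unfolding T_def by (subst s_std_5_minus) auto
    then show ?thesis unfolding T_def comm_swap[of "A i" "A j"] .
  qed
  have T1: "T p q r s i j = - T q p r s i j" for p q r s i j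
    unfolding T_def by (subst s_std_5_swap(2)) (rule fun_Compl_def[THEN fun_cong])
  have T2: "T p q r s i j = - T p r q s i j" for p q r s i j
    unfolding T_def by (subst s_std_5_swap(3)) (rule fun_Compl_def[THEN fun_cong])
  have T3: "T p q r s i j = - T p q s r i j" for p q r s i j
    unfolding T_def by (subst s_std_5_swap(4)) (rule fun_Compl_def[THEN fun_cong])
  have rotate: "s_std [a, b, c, d, e] = s_std [e, a, b, c, d]" for a b c d e :: oper
    by (simp only: s_std_5_swap(4)[of a b c d e] s_std_5_swap(3)[of a b c e d]
      s_std_5_swap(2)[of a b e c d] s_std_5_swap(1)[of a e b c d] minus_minus)
  have FT: "F [A p, A q, A r, A s, A i, A j] = T p q r s i j" for p q r s i j
    using rotate[of "A p" "A q" "A r" "A s" "comm (A i) (A j)"] by (simp add: F_def T_def)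
  have F5T: "F5 [A a, A b, A c, A d, A e, A g] = (\<Sum>\<tau> | \<tau> permutes {..<4::nat}.
    T a b c d e g - T e b c d a g - T a e c d b g - T a b e d c g - T a b c e d g)" for a b c d e g
    unfolding F5_def using inv4[of _ _ "A g"] by (simp add: alt_sum_cosets_5 FT)
  have sort: "j < i \<Longrightarrow> {p, q, r, s, i, j} \<subseteq> {..<6} \<Longrightarrow> T p q r s i j = - T p q r s j i"
    "q < p \<Longrightarrow> T p q r s i j = - T q p r s i j" "r < q \<Longrightarrow> T p q r s i j = - T p r q s i j"
    "s < r \<Longrightarrow> T p q r s i j = - T p q s r i j" for p q r s i j
    by (rule T0 T1 T2 T3; assumption?)+
  have "(\<Sum>\<tau> | \<tau> permutes {..<4::nat}. ?S + ?S) =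
    F5 [A 0, A 1, A 2, A 3, A 4, A 5] - F5 [A 5, A 1, A 2, A 3, A 4, A 0] - F5 [A 0, A 5, A 2, A 3, A 4, A 1]
    - F5 [A 0, A 1, A 5, A 3, A 4, A 2] - F5 [A 0, A 1, A 2, A 5, A 4, A 3] - F5 [A 0, A 1, A 2, A 3, A 5, A 4]"
    unfolding F5T sum_subtractf[symmetric]
    by (intro sum.cong refl) (simp add: sort algebra_simps)
  then have "?S + ?S = 0" using E sum_const_eq_0 by metis
  then have "2 * ?S = 0" by (simp only: mult_2)
  then show ?thesis by (simp only: mult_eq_0_iff) simp
qed

lemma adjoint_cocycle_s5: "adjoint_cocycle Vect2_0 s_std 5 s_std"
  unfolding adjoint_cocycle_def
proof (intro allI impI)
  fix as :: "oper list" assume as: "length as = 5 + 1 \<and> set as \<subseteq> Vect2_0"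
  define A where "A = (\<lambda>i. as ! i)"
  have A: "A i \<in> Vect2_0" if "i < 6" for i
    using as that by (auto simp: A_def)
  have asA: "as = [A 0, A 1, A 2, A 3, A 4, A 5]"
    unfolding A_def using as by (intro nth_equalityI) (auto simp: less_Suc_eq numeral_eq_Suc)
  let ?S1 = "\<Sum>j<5 + 1. \<Sum>i<j. alt_sign (i + j) (s_std (s_std [as ! i, as ! j] # nths as (- {i, j})))"
  let ?S2 = "\<Sum>i<5 + 1. alt_sign i (s_std [as ! i, s_std (nths as (- {i}))])"
  have l6: "{..<5 + 1} = {0, 1, 2, 3, 4, 5::nat}" by auto
  have lt: "{..<0::nat} = {}" "{..<1} = {0::nat}" "{..<2} = {0, 1::nat}" "{..<3} = {0, 1, 2::nat}"
    "{..<4} = {0, 1, 2, 3::nat}" "{..<5} = {0, 1, 2, 3, 4::nat}"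
    by auto
  show "?S1 + ?S2 = 0"
  proof
    fix f
    have "?S1 f = 0"
      using sum_s5_bracket_eq_0[of A f, OF A] unfolding l6 sum_apply asA
      by (simp add: lt alt_sign_def s_std_2 nths_def upt_rec algebra_simps)
    moreover have "?S2 f = 0"
      using sum_bracket_s5_eq_0[of A f, OF A] unfolding l6 sum_apply asA
      by (simp add: alt_sign_def s_std_2 nths_def upt_rec algebra_simps)
    ultimately show "(?S1 + ?S2) f = 0 f" by simp
  qed
qed

section \<open>Primitivity\<close>

text \<open>
  The Hamiltonian of a left-normed commutator of Hamiltonian fields.
\<close>

definition nest :: "U list \<Rightarrow> U" where
  "nest us = foldl (\<lambda>v u. ham u v) (hd us) (tl us)"

lemma left_normed_comm_ham:
  assumes "us \<noteq> []"
  shows "left_normed comm (map ham us) = ham (nest us)"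
proof -
  have "foldl comm (ham v) (map ham us) = ham (foldl (\<lambda>v u. ham u v) v us)" for v us
    by (induction us arbitrary: v) (simp_all add: ham_ham)
  then show ?thesis using assms by (cases us) (simp_all add: left_normed_def nest_def)
qed

text \<open>
  Rotating the first three arguments is even, so the alternating sum does not change when the
  function is replaced by any of its three rotations; by the Jacobi identity these add up to 0.
\<close>

lemma alt_sum_nest_eq_0:
  assumes us: "length us = 5"
  shows "alt_sum nest us = 0"
proof -
  \<comment> \<open>the rotation of the first three positions\<close>
  define \<rho> where "\<rho> = transpose 0 1 \<circ> transpose 1 (2::nat)"
  have t: "transpose 0 1 permutes {..<5::nat}" "transpose 1 2 permutes {..<5::nat}"
    by (auto intro!: permutes_swap_id)
  then have \<rho>: "\<rho> permutes {..<length ys}" if "length ys = 5" for ys :: "U list"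
    unfolding \<rho>_def that by (rule permutes_compose[rotated])
  have sg: "signed \<rho> x = x" for x :: U
    unfolding \<rho>_def signed_compose[OF permutation_lessThan[OF t(1)] permutation_lessThan[OF t(2)]]
    by (simp add: signed_def sign_swap_id)
  have 1: "alt_sum (\<lambda>ys. nest (permute_list \<rho> ys)) us = alt_sum nest us"
    using alt_sum_reindex[OF \<rho>[OF us], of nest] sg by simp
  have 2: "alt_sum (\<lambda>ys. nest (permute_list \<rho> (permute_list \<rho> ys))) us = alt_sum nest us"
    using alt_sum_reindex[OF \<rho>[OF us], of "\<lambda>ys. nest (permute_list \<rho> ys)"] 1 sg by simp
  have "alt_sum nest us + alt_sum nest us + alt_sum nest us =
    alt_sum (\<lambda>ys. nest ys + nest (permute_list \<rho> ys) + nest (permute_list \<rho> (permute_list \<rho> ys))) us"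
    by (simp only: alt_sum_add 1 2)
  also have "\<dots> = alt_sum (\<lambda>_. 0) us"
  proof (rule alt_sum_cong)
    fix ys :: "U list" assume "length ys = length us"
    then obtain a b c d e where ys: "ys = [a, b, c, d, e]"
      using us by (auto simp: length_Suc_conv eval_nat_numeral)
    have p: "permute_list \<rho> [x, y, z, d, e] = [y, z, x, d, e]" for x y z :: U
    proof -
      have l: "length [x, y, z, d, e] = 5" by simp
      show ?thesis unfolding permute_list_def l upt_5 by (simp add: \<rho>_def transpose_def)
    qed
    have "ham c (ham b a) + ham a (ham c b) + ham b (ham a c) = 0"
      by (simp add: ham_apply d1_mult d2_mult d1_diff d2_diff d1_d2 algebra_simps)
    then have "ham e (ham d (ham c (ham b a) + ham a (ham c b) + ham b (ham a c))) = 0"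
      by (simp add: ham_apply)
    then show "nest ys + nest (permute_list \<rho> ys) + nest (permute_list \<rho> (permute_list \<rho> ys)) = 0"
      by (simp add: ys p nest_def ham_add)
  qed
  also have "\<dots> = 0" by (simp add: alt_sum_def)
  finally have "3 * alt_sum nest us = 0" by (simp add: algebra_simps)
  then show ?thesis by (simp only: mult_eq_0_iff) simp
qed

lemma nest_scale:
  assumes "w \<noteq> []" "set w \<subseteq> {..<length us}"
  shows "nest (map ((!) (us[k := const z * us ! k])) w) = const (z ^ count_list w k) * nest (map ((!) us) w)"
proof -
  define s where "s = (\<lambda>i. if i = k then z else 1)"
  have fold: "foldl (\<lambda>v i. ham (const (s i) * h i) v) (const a * v) w =
    const (a * z ^ count_list w k) * foldl (\<lambda>v i. ham (h i) v) v w" for h a v w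
  proof (induction w arbitrary: a v)
    case (Cons i w)
    have "ham (const (s i) * h i) (const a * v) = const (a * s i) * ham (h i) v"
      by (simp only: ham_scale ham_const const_mult_mult mult.commute[of a "s i"])
    then show ?case using Cons[of "a * s i" "ham (h i) v"] by (simp add: s_def mult.assoc)
  qed simp
  have nth: "us[k := const z * us ! k] ! i = const (s i) * us ! i" if "i < length us" for i
    using that by (auto simp: s_def nth_list_update)
  obtain i w' where w: "w = i # w'" using assms by (cases w) auto
  have "nest (map ((!) (us[k := const z * us ! k])) w) = nest (map (\<lambda>i. const (s i) * us ! i) w)"
    using assms nth by (intro arg_cong[of _ _ nest] map_cong) auto
  also have "\<dots> = const (s i * z ^ count_list w' k) * foldl (\<lambda>v i. ham (us ! i) v) (us ! i) w'"
    unfolding w nest_def using fold[of "(!) us" "s i" "us ! i" w'] by (simp add: foldl_map)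
  also have "\<dots> = const (z ^ count_list w k) * nest (map ((!) us) w)"
    unfolding w nest_def by (simp add: foldl_map s_def)
  finally show ?thesis .
qed

lemma coeff_const_mult: "coeff (coeff (const c * p) i) j = c * coeff (coeff p i) j"
  by (simp add: const_def)

text \<open>
  Comparison of the coefficients of \<open>z\<close>, carried out in each coefficient of the elements of \<open>U\<close>.
\<close>

lemma linear_part:
  fixes v :: "'w \<Rightarrow> U" and c :: "'w \<Rightarrow> complex"
  assumes "finite W" and eq: "\<And>z. const z * s = (\<Sum>w\<in>W. const (c w) * (const (z ^ n w) * v w))"
  shows "s = (\<Sum>w\<in>{w \<in> W. n w = 1}. const (c w) * v w)"
proof (intro poly_eqI)
  fix i j
  define cf where "cf = (\<lambda>p :: U. coeff (coeff p i) j)"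
  have cf_sum: "cf (\<Sum>w\<in>A. f w) = (\<Sum>w\<in>A. cf (f w))" for f :: "'w \<Rightarrow> U" and A
    by (simp add: cf_def coeff_sum)
  have cf_const: "cf (const a * p) = a * cf p" for a p
    by (simp add: cf_def coeff_const_mult)
  have "poly (monom (cf s) 1) z = poly (\<Sum>w\<in>W. monom (c w * cf (v w)) (n w)) z" for z
  proof -
    have "z * cf s = (\<Sum>w\<in>W. c w * (z ^ n w * cf (v w)))"
      using arg_cong[OF eq[of z], of cf] by (simp only: cf_sum cf_const)
    then show ?thesis by (simp add: poly_sum poly_monom mult_ac)
  qed
  then have "monom (cf s) 1 = (\<Sum>w\<in>W. monom (c w * cf (v w)) (n w))"
    unfolding poly_eq_poly_eq_iff[symmetric] by (rule ext)
  then have "coeff (monom (cf s) 1) 1 = coeff (\<Sum>w\<in>W. monom (c w * cf (v w)) (n w)) 1" by simp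
  then have "cf s = (\<Sum>w\<in>W. if n w = 1 then c w * cf (v w) else 0)"
    by (simp add: coeff_sum)
  also have "\<dots> = (\<Sum>w\<in>{w \<in> W. n w = 1}. c w * cf (v w))"
    using assms(1) by (simp only: sum.inter_filter)
  also have "\<dots> = cf (\<Sum>w\<in>{w \<in> W. n w = 1}. const (c w) * v w)"
    by (simp only: cf_sum cf_const)
  finally show "coeff (coeff s i) j = coeff (coeff (\<Sum>w\<in>{w \<in> W. n w = 1}. const (c w) * v w) i) j"
    by (simp add: cf_def)
qed

lemma jet_det_scale:
  assumes "length us = 5" "k < 5"
  shows "ham (jet_det (us[k := const z * us ! k])) f = const z * ham (jet_det us) f"
proof -
  have "us[k := const z * us ! k] = take k us @ (const z * us ! k) # drop (Suc k) us"
    using assms by (simp add: upd_conv_take_nth_drop)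
  moreover have "us = take k us @ us ! k # drop (Suc k) us"
    using assms by (simp add: id_take_nth_drop)
  moreover have "alt_sum (act' f) (take k us @ (const z * us ! k) # drop (Suc k) us) =
     const z * alt_sum (act' f) (take k us @ us ! k # drop (Suc k) us)"
    if "act' = (\<lambda>f us. foldl (\<lambda>g u. ham u g) f us)" for act'
    unfolding that by (rule alt_sum_slot_scale) (simp_all add: ham_scale foldl_ham_const ring_distribs)
  ultimately have "alt_sum (foldl (\<lambda>g u. ham u g) f) (us[k := const z * us ! k]) =
    const z * alt_sum (foldl (\<lambda>g u. ham u g) f) us"
    by metis
  moreover have "s_std (map ham us) f = alt_sum (foldl (\<lambda>g u. ham u g) f) us" if "us \<noteq> []" for us f
    using that by (simp add: s_std_apply alt_sum_map foldl_map)
  moreover have "us \<noteq> []" "us[k := const z * us ! k] \<noteq> []" using assms by auto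
  ultimately have "s_std (map ham (us[k := const z * us ! k])) f = const z * s_std (map ham us) f"
    by simp
  then show ?thesis using assms s5_ham[of us] s5_ham[of "us[k := const z * us ! k]"] by simp
qed

text \<open>
  Scaling the arguments one after the other discards all words in which some letter does not occur
  exactly once.
\<close>

lemma multilinear_part:
  assumes "finite W" "\<And>w. w \<in> W \<Longrightarrow> w \<noteq> [] \<and> set w \<subseteq> {..<5}"
    and eq: "\<And>us f. length us = 5 \<Longrightarrow>
      ham (jet_det us) f = (\<Sum>w\<in>W. const (c w) * ham (nest (map ((!) us) w)) f)"
    and "m \<le> 5" "length us = 5"
  shows "ham (jet_det us) f =
    (\<Sum>w\<in>{w \<in> W. \<forall>k<m. count_list w k = 1}. const (c w) * ham (nest (map ((!) us) w)) f)"
  using assms(4,5)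
proof (induction m arbitrary: us f)
  case 0
  then show ?case using eq by simp
next
  case (Suc k)
  let ?W = "{w \<in> W. \<forall>i<k. count_list w i = 1}"
  have "ham (jet_det us) f =
    (\<Sum>w\<in>{w \<in> ?W. count_list w k = 1}. const (c w) * ham (nest (map ((!) us) w)) f)"
  proof (rule linear_part)
    show "finite ?W" using assms(1) by simp
    fix z
    have "const z * ham (jet_det us) f = ham (jet_det (us[k := const z * us ! k])) f"
      using Suc.prems by (simp add: jet_det_scale)
    also have "\<dots> = (\<Sum>w\<in>?W. const (c w) * ham (nest (map ((!) (us[k := const z * us ! k])) w)) f)"
      using Suc.prems by (intro Suc.IH) auto
    also have "\<dots> = (\<Sum>w\<in>?W. const (c w) * (const (z ^ count_list w k) * ham (nest (map ((!) us) w)) f))"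
    proof (intro sum.cong refl)
      fix w assume "w \<in> ?W"
      then have w: "w \<noteq> []" "set w \<subseteq> {..<length us}" using assms(2) Suc.prems by auto
      show "const (c w) * ham (nest (map ((!) (us[k := const z * us ! k])) w)) f =
        const (c w) * (const (z ^ count_list w k) * ham (nest (map ((!) us) w)) f)"
        by (simp only: nest_scale[OF w] ham_scale)
    qed
    finally show "const z * ham (jet_det us) f =
      (\<Sum>w\<in>?W. const (c w) * (const (z ^ count_list w k) * ham (nest (map ((!) us) w)) f))" .
  qed
  also have "{w \<in> ?W. count_list w k = 1} = {w \<in> W. \<forall>i<Suc k. count_list w i = 1}"
    by (auto simp: less_Suc_eq)
  finally show ?case .
qed

lemma primitive_s5: "primitive_on Vect2_0 5 s_std"
  unfolding primitive_on_def
proof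
  assume "\<exists>f. nc_poly 5 f \<and> (\<forall>Xs. length Xs = 5 \<and> set Xs \<subseteq> Vect2_0 \<longrightarrow> s_std Xs = comm_eval f Xs)"
  then obtain p where p: "nc_poly 5 p"
    and eq: "\<And>Xs. length Xs = 5 \<Longrightarrow> set Xs \<subseteq> Vect2_0 \<Longrightarrow> s_std Xs = comm_eval p Xs"
    by blast
  define W where "W = Poly_Mapping.keys p"
  define c where "c = Poly_Mapping.lookup p"
  \<comment> \<open>the multilinear words, which are the permutations of the five letters\<close>
  define V where "V = {w \<in> W. \<forall>k<5. count_list w k = 1}"
  have W: "finite W" "\<And>w. w \<in> W \<Longrightarrow> w \<noteq> [] \<and> set w \<subseteq> {..<5}"
    using p by (auto simp: W_def nc_poly_def)
  have "ham (jet_det us) f = (\<Sum>w\<in>W. const (c w) * ham (nest (map ((!) us) w)) f)"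
    if us: "length us = 5" for us f
  proof -
    have "ham (jet_det us) = comm_eval p (map ham us)"
      using us eq[of "map ham us"] by (simp add: s5_ham Vect2_0_eq image_subset_iff)
    also have "\<dots> = (\<Sum>w\<in>W. cscale (c w) (ham (nest (map ((!) us) w))))"
      unfolding comm_eval_def W_def[symmetric] c_def[symmetric]
    proof (intro sum.cong refl arg_cong[of _ _ "cscale _"])
      fix w assume "w \<in> W"
      then have w: "w \<noteq> []" "set w \<subseteq> {..<5}" using W(2) by auto
      then have "map (\<lambda>i. map ham us ! i) w = map ham (map ((!) us) w)"
        using us by auto
      then show "left_normed comm (map (\<lambda>i. map ham us ! i) w) = ham (nest (map ((!) us) w))"
        using w by (simp only: left_normed_comm_ham map_is_Nil_conv not_False_eq_True)
    qed
    finally show ?thesis by (simp add: sum_apply cscale_apply)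
  qed
  from multilinear_part[OF W this order.refl]
  have V: "ham (jet_det us) f = (\<Sum>w\<in>V. const (c w) * ham (nest (map ((!) us) w)) f)"
    if "length us = 5" for us f
    using that unfolding V_def by blast
  have zero: "ham (jet_det us) f = 0" if us: "length us = 5" for us f
  proof -
    have alt0: "alt_sum (\<lambda>us. nest (map ((!) us) w)) us = 0" if "w \<in> V" for w
    proof -
      have "mset w = mset [0..<5]"
      proof (rule multiset_eqI)
        fix k
        have "w \<in> W" using that by (simp add: V_def)
        then have "set w \<subseteq> {..<5}" using W(2) by blast
        then show "count (mset w) k = count (mset [0..<5]) k"
          using that by (cases "k < 5") (auto simp: V_def count_mset intro!: count_notin)
      qed
      then obtain \<rho> where \<rho>: "\<rho> permutes {..<5}"
        "\<And>xs :: U list. length xs = 5 \<Longrightarrow> map ((!) xs) w = permute_list \<rho> xs"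
        using map_nth_permutation by blast
      have "alt_sum (\<lambda>us. nest (map ((!) us) w)) us = alt_sum (\<lambda>us. nest (permute_list \<rho> us)) us"
        using \<rho> us by (intro alt_sum_cong) simp
      also have "\<dots> = 0" using \<rho> us by (simp add: alt_sum_reindex alt_sum_nest_eq_0)
      finally show ?thesis .
    qed
    have hs: "h (\<Sum>w\<in>V. g w) = (\<Sum>w\<in>V. h (g w))"
      if "\<And>x y. h (x + y) = h x + h y" "h 0 = 0" for h :: "U \<Rightarrow> U" and g
      using that by (induction V rule: infinite_finite_induct) auto
    have "alt_sum (\<lambda>us. ham (jet_det us) f) us = alt_sum (\<lambda>us. \<Sum>w\<in>V. const (c w) * ham (nest (map ((!) us) w)) f) us"
      using us by (intro alt_sum_cong V) simp
    also have "\<dots> = (\<Sum>w\<in>V. const (c w) * ham (alt_sum (\<lambda>us. nest (map ((!) us) w)) us) f)"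
      unfolding alt_sum_sum
      by (intro sum.cong refl alt_sum_additive[where h = "\<lambda>x. const _ * ham x f"]) (simp add: ham_add_left ring_distribs)
    also have "\<dots> = 0" using alt0 by (simp add: ham_apply)
    finally have "alt_sum (\<lambda>us. ham (jet_det us) f) us = 0" .
    moreover have "alt_sum (\<lambda>us. ham (jet_det us) f) us = (\<Sum>\<sigma> | \<sigma> permutes {..<5::nat}. ham (jet_det us) f)"
      unfolding alt_sum_def us
    proof (intro sum.cong refl)
      fix \<sigma> :: "nat \<Rightarrow> nat" assume "\<sigma> \<in> {\<sigma>. \<sigma> permutes {..<5}}"
      then have \<sigma>: "\<sigma> permutes {..<length us}" using us by simp
      have "jet_det (permute_list \<sigma> us) = signed \<sigma> (jet_det us)"
        by (simp add: jet_det_def alt_sum_permute[OF \<sigma>] signed_mult_right)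
      moreover have "ham (signed \<sigma> g) f = signed \<sigma> (ham g f)" for g
        by (simp add: signed_def ham_apply d1_minus d2_minus)
      ultimately show "signed \<sigma> (ham (jet_det (permute_list \<sigma> us)) f) = ham (jet_det us) f" by simp
    qed
    ultimately show ?thesis by (metis sum_const_eq_0)
  qed
  obtain Xs where Xs: "length Xs = 5" "set Xs \<subseteq> Vect2_0" "s_std Xs \<noteq> 0" using s5_nonzero by blast
  then obtain us where us: "Xs = map ham us" using Vect2_0_list by blast
  then have len: "length us = 5" using Xs by simp
  have "s_std Xs = 0" unfolding us s5_ham[OF len] by (rule ext) (simp add: zero[OF len])
  then show False using Xs by blast
qed

section \<open>Properties of the five-commutator\<close>

theorem theorem3p2:
  shows
    "(\<exists>Xs. length Xs = 5 \<and> set Xs \<subseteq> Vect2_0 \<and> s_std Xs \<noteq> 0)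
   \<and> (\<forall>Xs. length Xs = 5 \<and> set Xs \<subseteq> Vect2_0 \<longrightarrow> s_std Xs \<in> Vect2_0)
   \<and> (\<forall>Xs. length Xs = 6 \<and> set Xs \<subseteq> Vect2_0 \<longrightarrow> s_std Xs = 0)
   \<and> primitive_on Vect2_0 5 s_std
   \<and> (\<forall>Xs. length Xs = 5 \<and> set Xs \<subseteq> Vect2_0 \<longrightarrow> s_std Xs = s_rsym_r Xs)
   \<and> (\<forall>Xs. length Xs = 5 \<and> set Xs \<subseteq> Vect2_0 \<longrightarrow>
        (\<forall>Y \<in> Vect2_0. ad (s_std Xs) Y = s_std (map ad Xs) Y))
   \<and> left_commutative cscale Vect2_0 5 s_std
   \<and> sh_lie cscale Vect2_0 s_std 5 s_std"
  using s5_nonzero s5_closed s6_eq_0 primitive_s5 s5_eq_rsym ad_s5 left_commutative_s5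
  by (auto simp: sh_lie_def lie_algebra_s2 homotopical_lie_s5 adjoint_cocycle_s5)

end
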